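(* Let $\mathbb{F}_q$ be a finite field and $n,d\geq 1$ integers with $(n,d)\neq (2,3),(3,4)$. Then the number of smooth degree $d$ hypersurfaces $X$ in $\mathbb{P}^n_{\mathbb{F}_q}$ with $\mathrm{Aut}_{\mathbb{F}_q}(X)\neq \{1\}$ is less than $q^{C\binom{n+d}{d}+(n+1)^2}$, where $C=1-\frac{1}{2^n}$.
   Context: A degree $d$ hypersurface in $\mathbb{P}^n_{\mathbb{F}_q}$ is the zero locus $X=V(f)$ of a nonzero homogeneous polynomial $f\in\mathbb{F}_q[x_1,\dots,x_{n+1}]$ of degree $d$. $\mathrm{Aut}_{\mathbb{F}_q}(X)$ denotes the group of automorphisms of $X$ defined over $\mathbb{F}_q$; for the $(n,d)$ considered these are the elements of $\mathrm{PGL}_{n+1}(\mathbb{F}_q)$ mapping $X$ to itself. *)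

theory Defs
  imports
    Complex_Main
    "HOL-Library.Cardinality"
    "HOL-Library.Poly_Mapping"
    "HOL-Algebra.Algebraic_Closure_Type"
    "HOL-Algebra.Coset"
    "Jordan_Normal_Form.Matrix"
begin

section \<open>Forms in \<open>n + 1\<close> variables\<close>

text \<open>The variables \<open>x\<^sub>1, \<dots>, x\<^bsub>n+1\<^esub>\<close> are indexed by \<open>0, \<dots>, n\<close>.\<close>

type_synonym 'a mpoly = "(nat \<Rightarrow>\<^sub>0 nat) \<Rightarrow>\<^sub>0 'a"

definition form :: "nat \<Rightarrow> nat \<Rightarrow> 'a::zero mpoly \<Rightarrow> bool" where
  "form n d f \<longleftrightarrow>
     (\<forall>m\<in>Poly_Mapping.keys f. Poly_Mapping.keys m \<subseteq> {..n} \<and> (\<Sum>i\<in>Poly_Mapping.keys m. Poly_Mapping.lookup m i) = d)"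

definition eval_mpoly :: "'a::comm_semiring_1 mpoly \<Rightarrow> 'a vec \<Rightarrow> 'a" where
  "eval_mpoly f v = (\<Sum>m\<in>Poly_Mapping.keys f. Poly_Mapping.lookup f m * (\<Prod>i\<in>Poly_Mapping.keys m. (v $ i) ^ Poly_Mapping.lookup m i))"

text \<open>The subtraction of exponents below truncates only for monomials not containing
  the variable; these have coefficient \<open>0\<close> in the derivative.\<close>

definition partial_deriv :: "nat \<Rightarrow> 'a::comm_semiring_1 mpoly \<Rightarrow> 'a mpoly" where
  "partial_deriv i f =
     (\<Sum>m\<in>Poly_Mapping.keys f. Poly_Mapping.single (m - Poly_Mapping.single i 1) (of_nat (Poly_Mapping.lookup m i) * Poly_Mapping.lookup f m))"

definition mpoly_ac :: "'a::field mpoly \<Rightarrow> 'a alg_closure mpoly" where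
  "mpoly_ac f = Poly_Mapping.map to_ac f"


section \<open>Projective space and hypersurfaces\<close>

text \<open>A point of \<open>\<bbbP>\<^sup>n(K)\<close> is the set of all its homogeneous coordinate vectors.\<close>

definition proj_point :: "'k::field vec \<Rightarrow> 'k vec set" where
  "proj_point v = {c \<cdot>\<^sub>v v | c. c \<noteq> 0}"

text \<open>The zero locus of a form over \<open>\<bbbF>\<^sub>q\<close> is its set of geometric points,
  i.e. of points with coordinates in an algebraic closure.\<close>

definition zero_locus :: "nat \<Rightarrow> 'a::field mpoly \<Rightarrow> 'a alg_closure vec set set" where
  "zero_locus n f =
     {proj_point v | v. v \<in> carrier_vec (n + 1) \<and> v \<noteq> 0\<^sub>v (n + 1) \<and> eval_mpoly (mpoly_ac f) v = 0}"

text \<open>Jacobian criterion at all geometric points. The condition on \<open>f\<close> itself is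
  not redundant: the characteristic may divide the degree.\<close>

definition smooth_form :: "nat \<Rightarrow> 'a::field mpoly \<Rightarrow> bool" where
  "smooth_form n f \<longleftrightarrow>
     \<not> (\<exists>v \<in> carrier_vec (n + 1). v \<noteq> 0\<^sub>v (n + 1) \<and> eval_mpoly (mpoly_ac f) v = 0 \<and>
          (\<forall>i\<le>n. eval_mpoly (partial_deriv i (mpoly_ac f)) v = 0))"

definition smooth_hypersurface :: "nat \<Rightarrow> nat \<Rightarrow> 'a::field alg_closure vec set set \<Rightarrow> bool" where
  "smooth_hypersurface n d Y \<longleftrightarrow>
     (\<exists>f :: 'a mpoly. f \<noteq> 0 \<and> form n d f \<and> smooth_form n f \<and> Y = zero_locus n f)"


section \<open>Projective linear groups and automorphisms\<close>

definition GL :: "'a::field itself \<Rightarrow> nat \<Rightarrow> 'a mat monoid" where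
  "GL ty m = units_of (ring_mat ty m ())"

definition scalar_mats :: "'a::field itself \<Rightarrow> nat \<Rightarrow> 'a mat set" where
  "scalar_mats ty m = {c \<cdot>\<^sub>m 1\<^sub>m m | c. c \<noteq> 0}"

definition PGL :: "'a::field itself \<Rightarrow> nat \<Rightarrow> 'a mat set monoid" where
  "PGL ty m = GL ty m Mod scalar_mats ty m"

text \<open>An element of the projective linear group is a coset of matrices, and a point is a set of
  vectors; all products of a matrix and a vector in them are the coordinate vectors of one point.\<close>

definition PGL_act :: "'a::field mat set \<Rightarrow> 'a alg_closure vec set \<Rightarrow> 'a alg_closure vec set" where
  "PGL_act g x = {map_mat to_ac A *\<^sub>v v | A v. A \<in> g \<and> v \<in> x}"

definition Aut :: "nat \<Rightarrow> 'a::field alg_closure vec set set \<Rightarrow> 'a mat set set" where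
  "Aut n Y = {g \<in> carrier (PGL TYPE('a) (n + 1)). PGL_act g ` Y = Y}"


section \<open>Well-definedness\<close>

lemma finite_forms: "finite {f :: 'a::{field,finite} mpoly. form n d f}"
proof -
  define M where "M = {m :: nat \<Rightarrow>\<^sub>0 nat. Poly_Mapping.keys m \<subseteq> {..n} \<and> (\<Sum>i\<in>Poly_Mapping.keys m. Poly_Mapping.lookup m i) = d}"
  have "Poly_Mapping.lookup ` M \<subseteq> {h. \<forall>i. (i \<in> {..n} \<longrightarrow> h i \<in> {..d}) \<and> (i \<notin> {..n} \<longrightarrow> h i = 0)}"
  proof clarify
    fix m i assume m: "m \<in> M"
    have "Poly_Mapping.lookup m i \<le> d" if "i \<in> Poly_Mapping.keys m"
      using m that member_le_sum[of i "Poly_Mapping.keys m" "Poly_Mapping.lookup m"] by (auto simp: M_def)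
    then show "(i \<in> {..n} \<longrightarrow> Poly_Mapping.lookup m i \<in> {..d}) \<and> (i \<notin> {..n} \<longrightarrow> Poly_Mapping.lookup m i = 0)"
      using m unfolding M_def by (cases "i \<in> Poly_Mapping.keys m") (blast, simp add: in_keys_iff)
  qed
  then have "finite (Poly_Mapping.lookup ` M)"
    by (rule finite_subset) (intro finite_set_of_finite_funs; simp)
  then have M: "finite M"
    by (rule finite_imageD) (auto intro: inj_onI poly_mapping_eqI)
  have "Poly_Mapping.lookup ` {f :: 'a mpoly. form n d f} \<subseteq>
      {h. \<forall>m. (m \<in> M \<longrightarrow> h m \<in> UNIV) \<and> (m \<notin> M \<longrightarrow> h m = 0)}"
    by (auto simp: form_def M_def in_keys_iff)
  then have "finite (Poly_Mapping.lookup ` {f :: 'a mpoly. form n d f})"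
    by (rule finite_subset) (intro finite_set_of_finite_funs M; simp)
  then show ?thesis
    by (rule finite_imageD) (auto intro: inj_onI poly_mapping_eqI)
qed

lemma finite_smooth_hypersurfaces:
  "finite {Y :: 'a::{field,finite} alg_closure vec set set. smooth_hypersurface n d Y}"
  by (rule finite_subset[OF _ finite_imageI[OF finite_forms[of n d], of "zero_locus n"]])
     (auto simp: smooth_hypersurface_def)

lemma group_GL: "group (GL TYPE('a::field) m)"
proof -
  interpret ring "ring_mat TYPE('a) m ()" by (rule ring_mat)
  show ?thesis unfolding GL_def by (rule units_group)
qed

lemma scalar_mats_normal: "scalar_mats TYPE('a::field) m \<lhd> GL TYPE('a) m"
proof -
  interpret R: ring "ring_mat TYPE('a) m ()" by (rule ring_mat)
  interpret group "GL TYPE('a) m" by (rule group_GL)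
  have GL_carrier: "carrier (GL TYPE('a) m) \<subseteq> carrier_mat m m"
    by (auto simp: GL_def units_of_def Units_def ring_mat_simps)
  have mult: "x \<otimes>\<^bsub>GL TYPE('a) m\<^esub> y = x * y" for x y
    by (simp add: GL_def units_of_def ring_mat_simps)
  have one: "\<one>\<^bsub>GL TYPE('a) m\<^esub> = 1\<^sub>m m"
    by (simp add: GL_def units_of_def ring_mat_simps)
  have smult: "(c \<cdot>\<^sub>m 1\<^sub>m m) * (e \<cdot>\<^sub>m 1\<^sub>m m) = (c * e) \<cdot>\<^sub>m (1\<^sub>m m :: 'a mat)" for c e
    by (subst mult_smult_assoc_mat[of _ m m _ m]) (auto intro!: eq_matI)
  have mem: "c \<cdot>\<^sub>m 1\<^sub>m m \<in> carrier (GL TYPE('a) m)" if "c \<noteq> 0" for c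
    using that smult[of c "inverse c"] smult[of "inverse c" c]
    by (auto simp: GL_def units_of_def Units_def ring_mat_simps
        intro!: bexI[of _ "inverse c \<cdot>\<^sub>m 1\<^sub>m m"] eq_matI)
  have inv: "inv\<^bsub>GL TYPE('a) m\<^esub> (c \<cdot>\<^sub>m 1\<^sub>m m) = inverse c \<cdot>\<^sub>m 1\<^sub>m m" if "c \<noteq> 0" for c
    using that mem[of c] mem[of "inverse c"] smult[of "inverse c" c]
    by (intro inv_equality) (auto simp: mult one intro!: eq_matI)
  have sub: "subgroup (scalar_mats TYPE('a) m) (GL TYPE('a) m)"
  proof (rule subgroupI)
    show "scalar_mats TYPE('a) m \<subseteq> carrier (GL TYPE('a) m)"
      by (auto simp: scalar_mats_def mem)
    show "scalar_mats TYPE('a) m \<noteq> {}"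
      by (auto simp: scalar_mats_def intro: exI[of _ 1])
    show "inv\<^bsub>GL TYPE('a) m\<^esub> a \<in> scalar_mats TYPE('a) m" if "a \<in> scalar_mats TYPE('a) m" for a
      using that by (auto simp: scalar_mats_def inv intro: exI[of _ "inverse _"])
    show "a \<otimes>\<^bsub>GL TYPE('a) m\<^esub> b \<in> scalar_mats TYPE('a) m"
      if "a \<in> scalar_mats TYPE('a) m" "b \<in> scalar_mats TYPE('a) m" for a b
      using that by (auto simp: scalar_mats_def mult smult intro: exI[of _ "_ * _"])
  qed
  have comm: "A * (c \<cdot>\<^sub>m 1\<^sub>m m) = (c \<cdot>\<^sub>m 1\<^sub>m m) * A" if "A \<in> carrier_mat m m" for A :: "'a mat" and c
    using that by (simp add: mult_smult_distrib[of A m m "1\<^sub>m m" m] mult_smult_assoc_mat[of "1\<^sub>m m" m m A m])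
  show ?thesis
  proof (rule normal_invI[OF sub])
    fix A h assume A: "A \<in> carrier (GL TYPE('a) m)" and h: "h \<in> scalar_mats TYPE('a) m"
    have hc: "h \<in> carrier (GL TYPE('a) m)" using sub h by (rule subgroup.mem_carrier)
    have "A \<otimes>\<^bsub>GL TYPE('a) m\<^esub> h = h \<otimes>\<^bsub>GL TYPE('a) m\<^esub> A"
      using A GL_carrier h by (auto simp: mult scalar_mats_def comm)
    then have "A \<otimes>\<^bsub>GL TYPE('a) m\<^esub> h \<otimes>\<^bsub>GL TYPE('a) m\<^esub> inv\<^bsub>GL TYPE('a) m\<^esub> A = h"
      using A hc by (simp add: m_assoc)
    then show "A \<otimes>\<^bsub>GL TYPE('a) m\<^esub> h \<otimes>\<^bsub>GL TYPE('a) m\<^esub> inv\<^bsub>GL TYPE('a) m\<^esub> A \<in> scalar_mats TYPE('a) m"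
      using h by simp
  qed
qed

lemma group_PGL: "group (PGL TYPE('a::field) m)"
  unfolding PGL_def by (rule normal.factorgroup_is_group[OF scalar_mats_normal])

end

theory Submission
  imports Defs "Jordan_Normal_Form.Char_Poly"
begin

text \<open>
  A form \<open>h\<close> of degree \<open>d\<close> vanishing on the smooth hypersurface \<open>V(f)\<close> of degree \<open>d\<close> is a multiple of
  \<open>f\<close>. Hence an automorphism of \<open>V(f)\<close> given by a matrix \<open>A\<close> makes \<open>f\<close> semi-invariant: \<open>f \<circ> A = c f\<close>.

  For non-scalar \<open>A\<close> the space of these \<open>f\<close> is small. After a conjugation some entry \<open>A\<^sub>i\<^sub>j\<close> with
  \<open>i \<noteq> j\<close> is nonzero. With \<open>a = d - \<lfloor>d/2\<rfloor>\<close>, consider the span of the monomials that are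
  divisible by \<open>x\<^sub>i ^ a\<close> but not by \<open>x\<^sub>j ^ a\<close>. A semi-invariant in this span is divisible by \<open>l ^ a\<close>,
  where \<open>l = x\<^sub>i \<circ> A\<close> involves \<open>x\<^sub>j\<close>; as its degree in \<open>x\<^sub>j\<close> is less than \<open>a\<close>, it is zero. The span has
  codimension at most one in \<open>x\<^sub>i ^ a\<close> times the forms of degree \<open>k = \<lfloor>d/2\<rfloor>\<close>, and
  \<open>2 ^ n * binomial (n + k) k \<ge> binomial (n + d) d\<close>, so the semi-invariants have dimension at most
  \<open>(1 - 2 ^ (-n)) * binomial (n + d) d + 1\<close>.

  Summing the projectivized eigenspaces over all \<open>c\<close> and over the projective linear group, whose
  order is at most \<open>q ^ ((n + 1)\<^sup>2 - 1)\<close>, gives the bound.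
\<close>

section \<open>Evaluation homomorphisms\<close>

definition mval :: "(nat \<Rightarrow> 'b::comm_ring_1) \<Rightarrow> (nat \<Rightarrow>\<^sub>0 nat) \<Rightarrow> 'b" where
  "mval y m = (\<Prod>i\<in>Poly_Mapping.keys m. y i ^ Poly_Mapping.lookup m i)"

text \<open>Coefficients pass through an arbitrary map \<open>\<phi>\<close>, and values lie in any
  commutative ring. One homomorphism theorem thus serves evaluation at points, extension of scalars,
  linear substitution (\<open>\<phi> = Cst\<close>) and restriction to lines.\<close>

definition peval :: "('a::zero \<Rightarrow> 'b::comm_ring_1) \<Rightarrow> (nat \<Rightarrow> 'b) \<Rightarrow> 'a mpoly \<Rightarrow> 'b" where
  "peval \<phi> y f = (\<Sum>m\<in>Poly_Mapping.keys f. \<phi> (Poly_Mapping.lookup f m) * mval y m)"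

definition Cst :: "'a::zero \<Rightarrow> 'a mpoly" where "Cst c = Poly_Mapping.single 0 c"

definition Var :: "nat \<Rightarrow> 'a::{zero,one} mpoly" where
  "Var i = Poly_Mapping.single (Poly_Mapping.single i 1) 1"

definition mdeg :: "(nat \<Rightarrow>\<^sub>0 nat) \<Rightarrow> nat" where
  "mdeg m = (\<Sum>i\<in>Poly_Mapping.keys m. Poly_Mapping.lookup m i)"

lemma form_iff:
  "form n d f \<longleftrightarrow> (\<forall>m\<in>Poly_Mapping.keys f. Poly_Mapping.keys m \<subseteq> {..n} \<and> mdeg m = d)"
  by (simp add: form_def mdeg_def)

lemma mdeg_superset:
  assumes "finite S" "Poly_Mapping.keys m \<subseteq> S"
  shows "mdeg m = (\<Sum>i\<in>S. Poly_Mapping.lookup m i)"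
  unfolding mdeg_def using assms by (intro sum.mono_neutral_left) (auto simp: in_keys_iff)

lemma mval_superset:
  assumes "finite S" "Poly_Mapping.keys m \<subseteq> S"
  shows "mval y m = (\<Prod>i\<in>S. y i ^ Poly_Mapping.lookup m i)"
  unfolding mval_def using assms by (intro prod.mono_neutral_left) (auto simp: in_keys_iff)

lemma keys_add_exponents:
  "Poly_Mapping.keys (m + m' :: nat \<Rightarrow>\<^sub>0 nat) = Poly_Mapping.keys m \<union> Poly_Mapping.keys m'"
  by (auto simp: in_keys_iff lookup_add)

lemma mdeg_add: "mdeg (m + m') = mdeg m + mdeg m'"
proof -
  let ?S = "Poly_Mapping.keys m \<union> Poly_Mapping.keys m'"
  show ?thesis
    by (simp add: mdeg_superset[of ?S] keys_add_exponents lookup_add sum.distrib)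
qed

lemma mdeg_single [simp]: "mdeg (Poly_Mapping.single i k) = k"
  by (simp add: mdeg_def)

lemma mdeg_0 [simp]: "mdeg 0 = 0"
  by (simp add: mdeg_def)

lemma mval_add: "mval y (m + m') = mval y m * mval y m'"
proof -
  let ?S = "Poly_Mapping.keys m \<union> Poly_Mapping.keys m'"
  show ?thesis
    by (simp add: mval_superset[of ?S] keys_add_exponents lookup_add power_add prod.distrib)
qed

lemma mval_0 [simp]: "mval y 0 = 1"
  by (simp add: mval_def)

lemma mval_single [simp]: "mval y (Poly_Mapping.single i k) = y i ^ k"
  by (simp add: mval_def)

lemma sum_singles:
  fixes f :: "'k \<Rightarrow>\<^sub>0 'a::comm_monoid_add"
  shows "(\<Sum>m\<in>Poly_Mapping.keys f. Poly_Mapping.single m (Poly_Mapping.lookup f m)) = f"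
  by (rule poly_mapping_eqI) (auto simp: lookup_sum lookup_single when_def in_keys_iff)

lemma eval_mpoly_peval: "eval_mpoly f v = peval id (($) v) f"
  by (simp add: eval_mpoly_def peval_def mval_def)

context comm_ring_hom
begin

lemma peval_superset:
  assumes "finite S" "Poly_Mapping.keys f \<subseteq> S"
  shows "peval hom y f = (\<Sum>m\<in>S. hom (Poly_Mapping.lookup f m) * mval y m)"
  unfolding peval_def using assms by (intro sum.mono_neutral_left) (auto simp: in_keys_iff)

lemma peval_single: "peval hom y (Poly_Mapping.single m c) = hom c * mval y m"
  by (subst peval_superset[of "{m}"]) auto

lemma peval_add: "peval hom y (f + g) = peval hom y f + peval hom y g"
proof -
  let ?S = "Poly_Mapping.keys f \<union> Poly_Mapping.keys g"
  have "Poly_Mapping.keys (f + g) \<subseteq> ?S" by (rule keys_add)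
  then show ?thesis
    by (simp add: peval_superset[of ?S] lookup_add hom_add distrib_right sum.distrib)
qed

lemma peval_0 [simp]: "peval hom y 0 = 0"
  by (simp add: peval_def)

lemma peval_sum: "peval hom y (sum F S) = (\<Sum>s\<in>S. peval hom y (F s))"
  by (induction S rule: infinite_finite_induct) (simp_all add: peval_add)

lemma peval_mult: "peval hom y (f * g) = peval hom y f * peval hom y g"
proof -
  let ?s = Poly_Mapping.single and ?l = Poly_Mapping.lookup and ?k = Poly_Mapping.keys
  have "f * g = (\<Sum>a\<in>?k f. ?s a (?l f a)) * (\<Sum>b\<in>?k g. ?s b (?l g b))"
    by (simp add: sum_singles)
  also have "\<dots> = (\<Sum>a\<in>?k f. \<Sum>b\<in>?k g. ?s (a + b) (?l f a * ?l g b))"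
    by (simp add: sum_product mult_single)
  finally have "peval hom y (f * g) = (\<Sum>a\<in>?k f. \<Sum>b\<in>?k g. hom (?l f a * ?l g b) * mval y (a + b))"
    by (simp add: peval_sum peval_single)
  also have "\<dots> = peval hom y f * peval hom y g"
    unfolding peval_def sum_product by (simp add: hom_mult mval_add mult_ac)
  finally show ?thesis .
qed

lemma peval_1: "peval hom y 1 = 1"
  by (simp add: peval_single flip: single_one)

lemma comm_ring_hom_peval: "comm_ring_hom (peval hom y)"
  by standard (simp_all add: peval_add peval_mult peval_1)

lemma peval_Cst: "peval hom y (Cst c) = hom c"
  by (simp add: Cst_def peval_single)

lemma peval_Var: "peval hom y (Var i) = y i"
  by (simp add: Var_def peval_single)

lemma hom_mval: "hom (mval y m) = mval (\<lambda>i. hom (y i)) m"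
  by (simp add: mval_def hom_prod hom_power)

text \<open>Reduces later identities between composite substitutions to a comparison on constants
  and variables.\<close>

lemma hom_peval: "hom (peval \<phi> y f) = peval (\<lambda>c. hom (\<phi> c)) (\<lambda>i. hom (y i)) f"
  by (simp add: peval_def hom_sum hom_mult hom_mval)

end

lemma mval_cong: "(\<And>i. i \<in> Poly_Mapping.keys m \<Longrightarrow> y i = z i) \<Longrightarrow> mval y m = mval z m"
  by (simp add: mval_def)

text \<open>Values beyond index \<open>n\<close> are junk that can be chosen freely, so functions on
  all naturals can represent coordinate vectors.\<close>

lemma peval_cong:
  assumes "form n d f" "\<And>i. i \<le> n \<Longrightarrow> y i = z i"
  shows "peval \<phi> y f = peval \<phi> z f"
  unfolding peval_def
  by (intro sum.cong refl arg_cong2[of _ _ _ _ "(*)"] mval_cong) (use assms in \<open>auto simp: form_def\<close>)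

lemma Cst_0 [simp]: "Cst 0 = 0" by (simp add: Cst_def)
lemma Cst_1: "Cst 1 = 1" by (simp add: Cst_def single_one)
lemma Cst_add: "Cst (a + b) = Cst a + Cst b" by (simp add: Cst_def single_add)
lemma Cst_mult: "Cst (a * b) = Cst a * Cst (b::'a::comm_semiring_1)" by (simp add: Cst_def mult_single)
lemma Cst_eq_0_iff [simp]: "Cst a = 0 \<longleftrightarrow> a = 0" by (metis Cst_def lookup_single_eq lookup_zero single_zero)

lemma lookup_Cst_mult: "Poly_Mapping.lookup (Cst c * f) m = c * Poly_Mapping.lookup (f :: 'a::comm_ring_1 mpoly) m"
proof -
  let ?s = Poly_Mapping.single and ?l = Poly_Mapping.lookup and ?k = Poly_Mapping.keys
  have "Cst c * f = Cst c * (\<Sum>a\<in>?k f. ?s a (?l f a))" by (simp add: sum_singles)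
  also have "\<dots> = (\<Sum>a\<in>?k f. ?s a (c * ?l f a))"
    by (simp add: sum_distrib_left Cst_def mult_single)
  finally show ?thesis
    by (auto simp: lookup_sum lookup_single when_def in_keys_iff)
qed

lemma comm_ring_hom_Cst: "comm_ring_hom (Cst :: 'a::comm_ring_1 \<Rightarrow> 'a mpoly)"
  by standard (simp_all add: Cst_1 Cst_add Cst_mult)

lemma comm_ring_hom_id: "comm_ring_hom id" by standard auto

lemma comm_ring_hom_comp:
  assumes "comm_ring_hom f" "comm_ring_hom g"
  shows "comm_ring_hom (\<lambda>x. f (g x))"
proof -
  interpret f: comm_ring_hom f by fact
  interpret g: comm_ring_hom g by fact
  show ?thesis by standard (simp_all add: f.hom_add g.hom_add f.hom_mult g.hom_mult)
qed

lemma comm_ring_hom_const_poly: "comm_ring_hom (\<lambda>c::'a::comm_ring_1. [:c:])"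
  by standard (simp_all add: one_pCons)

lemma comm_ring_hom_poly: "comm_ring_hom (\<lambda>p. Polynomial.poly p (a::'a::comm_ring_1))"
  by standard simp_all

lemma comm_ring_hom_to_ac: "comm_ring_hom to_ac"
  by standard simp_all

lemma mval_Var: "mval Var m = Poly_Mapping.single m (1::'a::comm_ring_1)"
proof -
  have "mval Var m = (\<Prod>i\<in>Poly_Mapping.keys m. Poly_Mapping.single (Poly_Mapping.single i (Poly_Mapping.lookup m i)) (1::'a))"
    unfolding mval_def
  proof (intro prod.cong refl)
    fix i k show "Var i ^ k = Poly_Mapping.single (Poly_Mapping.single i k) (1::'a)" for k
      by (induction k) (simp_all add: Var_def mult_single single_one flip: single_add)
  qed
  also have "\<dots> = Poly_Mapping.single (\<Sum>i\<in>Poly_Mapping.keys m. Poly_Mapping.single i (Poly_Mapping.lookup m i)) 1"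
  proof -
    have "(\<Prod>i\<in>S. Poly_Mapping.single (h i) (1::'a)) = Poly_Mapping.single (sum h S) 1" if "finite S" for S :: "nat set" and h :: "nat \<Rightarrow> (nat \<Rightarrow>\<^sub>0 nat)"
      using that by induction (simp_all add: single_one mult_single)
    then show ?thesis by simp
  qed
  finally show ?thesis by (simp add: sum_singles)
qed

text \<open>Restores \<open>f\<close> at the end of a specialization, as when the parameter of a
  line is set to 0.\<close>

lemma peval_Cst_Var: "peval Cst Var f = (f :: 'a::comm_ring_1 mpoly)"
  by (simp add: peval_def mval_Var Cst_def mult_single sum_singles)

section \<open>Closure properties of the spaces of forms\<close>

lemma form_0 [simp]: "form n d 0"
  by (simp add: form_def)

lemma form_add: "form n d f \<Longrightarrow> form n d g \<Longrightarrow> form n d (f + g)"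
  using keys_add[of f g] by (auto simp: form_iff)

lemma form_diff: "form n d f \<Longrightarrow> form n d g \<Longrightarrow> form n d (f - g :: 'a::ab_group_add mpoly)"
  using keys_diff[of f g] by (auto simp: form_iff)

lemma form_sum: "(\<And>s. s \<in> S \<Longrightarrow> form n d (F s)) \<Longrightarrow> form n d (sum F S)"
  by (induction S rule: infinite_finite_induct) (simp_all add: form_add)

lemma form_mult:
  assumes "form n d f" "form n e g"
  shows "form n (d + e) (f * g)"
proof -
  have "Poly_Mapping.keys (f * g) \<subseteq> {a + b | a b. a \<in> Poly_Mapping.keys f \<and> b \<in> Poly_Mapping.keys g}"
    by (rule keys_mult)
  then show ?thesis using assms by (fastforce simp: form_iff mdeg_add keys_add_exponents)
qed

lemma form_Cst: "form n 0 (Cst c)"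
  by (simp add: form_def Cst_def)

lemma form_Var: "i \<le> n \<Longrightarrow> form n 1 (Var i)"
  by (auto simp: form_iff Var_def split: if_splits)

lemma form_1: "form n 0 1"
  by (metis form_Cst Cst_1)

lemma form_power: "form n d f \<Longrightarrow> form n (k * d) (f ^ k)"
  by (induction k) (simp_all add: form_1 form_mult)

lemma form_prod: "finite S \<Longrightarrow> (\<And>s. s \<in> S \<Longrightarrow> form n (D s) (F s)) \<Longrightarrow> form n (sum D S) (prod F S)"
  by (induction S rule: finite_induct) (simp_all add: form_1 form_mult)

lemma form_Cst_mult: "form n d f \<Longrightarrow> form n d (Cst c * f)"
  using form_mult[OF form_Cst[of n c], of d f] by simp

lemma form_peval:
  assumes f: "form n d f" and y: "\<And>i. i \<le> n \<Longrightarrow> form n 1 (y i)"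
  shows "form n d (peval Cst y f)"
  unfolding peval_def
proof (intro form_sum form_Cst_mult)
  fix m assume "m \<in> Poly_Mapping.keys f"
  then have m: "Poly_Mapping.keys m \<subseteq> {..n}" "mdeg m = d" using f by (auto simp: form_iff)
  have "form n (\<Sum>i\<in>Poly_Mapping.keys m. Poly_Mapping.lookup m i * 1) (mval y m)"
    unfolding mval_def using m y by (intro form_prod form_power) auto
  then show "form n d (mval y m)" using m by (simp add: mdeg_def)
qed

section \<open>Hypersurfaces and the vanishing of forms\<close>

text \<open>Over a finite field, the product of all \<open>X - a\<close> plus 1 is a nonconstant
  polynomial without roots.\<close>

lemma infinite_UNIV_alg_closed: "infinite (UNIV :: 'a::alg_closed_field set)"
proof
  assume fin: "finite (UNIV :: 'a set)"
  define p where "p = (\<Prod>a\<in>(UNIV :: 'a set). [:- a, 1:]) + 1"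
  have "Polynomial.degree (\<Prod>a\<in>(UNIV :: 'a set). [:- a, 1:]) = card (UNIV :: 'a set)"
    by (subst degree_prod_eq_sum_degree) auto
  moreover have "card (UNIV :: 'a set) > 0" using fin by (simp add: finite_UNIV_card_ge_0)
  ultimately have "Polynomial.degree p > 0"
    unfolding p_def by (subst degree_add_eq_left) auto
  then obtain x where "Polynomial.poly p x = 0" using alg_closed_imp_poly_has_root by blast
  moreover have "(\<Prod>a\<in>UNIV. x - a) = 0" using fin by (simp add: prod_zero_iff)
  ultimately show False by (simp add: p_def poly_prod)
qed

text \<open>Reduction modulo \<open>B\<close> yields the lowest digit, and division by
  \<open>B\<close> shifts the others. This makes the Kronecker substitution below injective on
  monomials.\<close>

lemma base_digits_unique:
  fixes a b :: "nat \<Rightarrow> nat"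
  assumes "(\<Sum>i<N. a i * B ^ i) = (\<Sum>i<N. b i * B ^ i)" "\<And>i. i < N \<Longrightarrow> a i < B" "\<And>i. i < N \<Longrightarrow> b i < B" "i < N"
  shows "a i = b i"
  using assms
proof (induction N arbitrary: a b i)
  case (Suc N)
  have split: "(\<Sum>i<Suc N. c i * B ^ i) = c 0 + B * (\<Sum>i<N. c (Suc i) * B ^ i)" for c :: "nat \<Rightarrow> nat"
    by (simp only: sum.lessThan_Suc_shift sum_distrib_left) (simp add: mult_ac)
  have eq: "a 0 + B * (\<Sum>i<N. a (Suc i) * B ^ i) = b 0 + B * (\<Sum>i<N. b (Suc i) * B ^ i)"
    using Suc.prems(1) by (simp only: split)
  have lt: "a 0 < B" "b 0 < B" using Suc.prems by auto
  have 0: "a 0 = b 0" using arg_cong[OF eq, of "\<lambda>x. x mod B"] lt by simp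
  have "(\<Sum>i<N. a (Suc i) * B ^ i) = (\<Sum>i<N. b (Suc i) * B ^ i)" using eq 0 lt by simp
  then have "a (Suc j) = b (Suc j)" if "j < N" for j
    using Suc.IH[of "\<lambda>i. a (Suc i)" "\<lambda>i. b (Suc i)" j] Suc.prems that by simp
  then show ?case using 0 Suc.prems(4) by (cases i) auto
qed simp

text \<open>Kronecker substitution \<open>x\<^sub>i \<mapsto> t ^ (B ^ i)\<close>.\<close>

lemma exists_nonzero_value:
  fixes f :: "'a::idom mpoly"
  assumes inf: "infinite (UNIV :: 'a set)" and "f \<noteq> 0"
  shows "\<exists>x. peval id x f \<noteq> 0"
proof -
  interpret C: comm_ring_hom "\<lambda>c::'a. [:c:]" by (rule comm_ring_hom_const_poly)
  let ?l = Poly_Mapping.lookup and ?k = Poly_Mapping.keys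
  obtain m0 where m0: "m0 \<in> ?k f" using \<open>f \<noteq> 0\<close> by (metis ex_in_conv keys_eq_empty)
  obtain N where N: "(\<Union>m\<in>?k f. ?k m) \<subseteq> {..<N}"
    using finite_nat_iff_bounded by (metis finite_UN finite_keys)
  have "finite (\<Union>m\<in>?k f. ?l m ` ?k m)" by simp
  then obtain B where B: "(\<Union>m\<in>?k f. ?l m ` ?k m) \<subseteq> {..<B}" using finite_nat_iff_bounded by blast
  \<comment> \<open>The base is \<open>Suc B\<close> so that the exponent 0 of an absent variable is
    also a valid digit, even if \<open>B = 0\<close>.\<close>
  have lB: "?l m i < Suc B" if "m \<in> ?k f" for m i
  proof (cases "i \<in> ?k m")
    case True then show ?thesis using B that by force
  qed (simp add: in_keys_iff)
  define w where "w m = (\<Sum>i<N. ?l m i * Suc B ^ i)" for m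
  define Q where "Q = peval (\<lambda>c. [:c:]) (\<lambda>i. Polynomial.monom 1 (Suc B ^ i)) f"
  have "mval (\<lambda>i. Polynomial.monom 1 (Suc B ^ i)) m = Polynomial.monom (1::'a) (w m)" if "m \<in> ?k f" for m
  proof -
    have "mval (\<lambda>i. Polynomial.monom (1::'a) (Suc B ^ i)) m = (\<Prod>i<N. Polynomial.monom 1 (?l m i * Suc B ^ i))"
      using N that by (subst mval_superset[of "{..<N}"]) (auto simp: monom_power mult_ac)
    also have "\<dots> = Polynomial.monom 1 (w m)"
      unfolding w_def by (induction N) (simp_all add: mult_monom)
    finally show ?thesis .
  qed
  then have Q: "Q = (\<Sum>m\<in>?k f. Polynomial.monom (?l f m) (w m))"
    unfolding Q_def peval_def by (intro sum.cong) (auto simp: smult_monom)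
  \<comment> \<open>Distinct exponent vectors of \<open>f\<close> have distinct weights, so nothing
    can cancel the term of \<open>m0\<close> in \<open>Q\<close>.\<close>
  have inj: "m = m0" if "m \<in> ?k f" "w m = w m0" for m
  proof (rule poly_mapping_eqI)
    fix i show "?l m i = ?l m0 i"
    proof (cases "i < N")
      case True
      then show ?thesis
        using base_digits_unique[of "?l m" "Suc B" N "?l m0" i] that(2) lB[OF that(1)] lB[OF m0] by (simp add: w_def)
    next
      case False
      then have "i \<notin> ?k m" "i \<notin> ?k m0" using N that m0 by auto
      then show ?thesis by (simp add: in_keys_iff)
    qed
  qed
  have "Polynomial.coeff Q (w m0) = (\<Sum>m\<in>?k f. if m = m0 then ?l f m else 0)"
    unfolding Q coeff_sum by (intro sum.cong) (auto dest: inj)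
  then have "Polynomial.coeff Q (w m0) = ?l f m0" using m0 by simp
  then have "Q \<noteq> 0" using m0 by (auto simp: in_keys_iff)
  then obtain t where t: "Polynomial.poly Q t \<noteq> 0"
    using poly_roots_finite[of Q] inf by (metis (mono_tags, lifting) Collect_cong UNIV_def)
  have "Polynomial.poly Q t = peval id (\<lambda>i. Polynomial.poly (Polynomial.monom 1 (Suc B ^ i)) t) f"
    unfolding Q_def comm_ring_hom.hom_peval[OF comm_ring_hom_poly] by (simp add: peval_def)
  then show ?thesis using t by metis
qed

text \<open>Since the coefficient ring is not a field, a greatest common divisor \<open>G\<close> exists only up to
  the factors \<open>c\<close>, \<open>c'\<close>, \<open>r\<close> from that ring.\<close>

lemma pseudo_bezout:
  fixes F H :: "'r::idom poly"
  assumes "F \<noteq> 0"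
  shows "\<exists>c c' r G F\<^sub>1 H\<^sub>1 a b. c \<noteq> 0 \<and> c' \<noteq> 0 \<and> r \<noteq> 0 \<and>
    Polynomial.smult c F = G * F\<^sub>1 \<and> Polynomial.smult c' H = G * H\<^sub>1 \<and> a * F\<^sub>1 + b * H\<^sub>1 = [:r:]"
  using assms
\<comment> \<open>The zero polynomial has to count as smaller than a nonzero constant, hence the
  \<open>Suc\<close> in the measure.\<close>
proof (induction "if H = 0 then 0 else Suc (Polynomial.degree H)" arbitrary: F H rule: less_induct)
  case less
  show ?case
  proof (cases "H = 0")
    case True
    then show ?thesis
      by (intro exI[of _ 1] exI[of _ F] exI[of _ 0] conjI) (auto simp: one_pCons)
  next
    case False
    obtain e q where e: "e \<noteq> 0" "Polynomial.smult e F = H * q + pseudo_mod F H"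
      using pseudo_mod(1)[OF False] by blast
    define S where "S = pseudo_mod F H"
    have "S = 0 \<or> Polynomial.degree S < Polynomial.degree H"
      unfolding S_def by (rule pseudo_mod(2)[OF False])
    then have "(if S = 0 then 0 else Suc (Polynomial.degree S)) < (if H = 0 then 0 else Suc (Polynomial.degree H))"
      using False by auto
    then obtain c c' r G H\<^sub>1 S\<^sub>1 a b where IH: "c \<noteq> 0" "c' \<noteq> 0" "r \<noteq> 0"
        "Polynomial.smult c H = G * H\<^sub>1" "Polynomial.smult c' S = G * S\<^sub>1" "a * H\<^sub>1 + b * S\<^sub>1 = [:r:]"
      using less.hyps[of S H] False by blast
    \<comment> \<open>Back substitution of the extended Euclidean algorithm without denominators:
      multiplying \<open>e F = H q + S\<close> by \<open>c c'\<close> exposes \<open>G\<close> in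
      both summands, and \<open>c S\<^sub>1 = F\<^sub>1 - c' q H\<^sub>1\<close> then converts the
      Bezout relation.\<close>
    define F\<^sub>1 where "F\<^sub>1 = Polynomial.smult c' (q * H\<^sub>1) + Polynomial.smult c S\<^sub>1"
    have "Polynomial.smult (c * c' * e) F = Polynomial.smult (c * c') (H * q + S)"
      using e by (simp add: S_def flip: smult_smult)
    also have "\<dots> = Polynomial.smult c' (Polynomial.smult c H * q) + Polynomial.smult c (Polynomial.smult c' S)"
      by (simp add: smult_add_right mult_ac)
    also have "\<dots> = G * F\<^sub>1" unfolding IH F\<^sub>1_def by (simp add: algebra_simps)
    finally have 1: "Polynomial.smult (c * c' * e) F = G * F\<^sub>1" .
    have "b * F\<^sub>1 + (Polynomial.smult c a - Polynomial.smult c' (b * q)) * H\<^sub>1 = Polynomial.smult c (a * H\<^sub>1 + b * S\<^sub>1)"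
      unfolding F\<^sub>1_def by (simp add: algebra_simps smult_add_right)
    then have 2: "b * F\<^sub>1 + (Polynomial.smult c a - Polynomial.smult c' (b * q)) * H\<^sub>1 = [:c * r:]"
      unfolding IH by simp
    have "c * c' * e \<noteq> 0" "c * r \<noteq> 0" using IH e by auto
    then show ?thesis using 1 2 IH(1,4) by blast
  qed
qed

section \<open>Top coefficients of products\<close>

lemma coeff_mult_degree_le:
  fixes p q :: "'a::comm_ring_1 poly"
  assumes "Polynomial.degree p \<le> a" "Polynomial.degree q \<le> b"
  shows "Polynomial.coeff (p * q) (a + b) = Polynomial.coeff p a * Polynomial.coeff q b"
proof -
  have "Polynomial.coeff p i * Polynomial.coeff q (a + b - i) = (if i = a then Polynomial.coeff p a * Polynomial.coeff q b else 0)"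
    if "i \<le> a + b" for i
  proof -
    consider "i < a" | "i = a" | "i > a" by linarith
    then show ?thesis
    proof cases
      case 1
      then have "Polynomial.coeff q (a + b - i) = 0" using assms by (intro coeff_eq_0) auto
      then show ?thesis using 1 by simp
    next
      case 3
      then have "Polynomial.coeff p i = 0" using assms by (intro coeff_eq_0) auto
      then show ?thesis using 3 by simp
    qed simp
  qed
  then show ?thesis by (simp add: coeff_mult)
qed

text \<open>Degree bounds replace exact degrees because a factor \<open>[:Var i, Cst (P i):]\<close>
  of a restricted monomial is constant when \<open>P i\<close> is 0.\<close>

lemma degree_prod_coeff:
  fixes p :: "'i \<Rightarrow> 'a::comm_ring_1 poly"
  assumes "finite S" "\<And>i. i \<in> S \<Longrightarrow> Polynomial.degree (p i) \<le> e i"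
  shows "Polynomial.degree (prod p S) \<le> sum e S \<and> Polynomial.coeff (prod p S) (sum e S) = (\<Prod>i\<in>S. Polynomial.coeff (p i) (e i))"
  using assms
proof (induction S rule: finite_induct)
  case (insert i S)
  then have *: "Polynomial.degree (p i) \<le> e i" "Polynomial.degree (prod p S) \<le> sum e S" by auto
  have "Polynomial.degree (p i * prod p S) \<le> e i + sum e S"
    using degree_mult_le[of "p i" "prod p S"] * by linarith
  then show ?case using * insert coeff_mult_degree_le[of "p i" "e i" "prod p S" "sum e S"] by auto
qed simp

lemma degree_power_coeff:
  fixes p :: "'a::comm_ring_1 poly"
  assumes "Polynomial.degree p \<le> e"
  shows "Polynomial.degree (p ^ k) \<le> k * e \<and> Polynomial.coeff (p ^ k) (k * e) = Polynomial.coeff p e ^ k"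
  using degree_prod_coeff[of "{..<k}" "\<lambda>_. p" "\<lambda>_. e"] assms by simp

section \<open>Restriction to lines and first-order expansion\<close>

text \<open>The restriction to the line \<open>x + t P\<close> through the generic point \<open>x\<close>, as a polynomial in \<open>t\<close>.\<close>

definition line_poly :: "(nat \<Rightarrow> 'a) \<Rightarrow> 'a::comm_ring_1 mpoly \<Rightarrow> 'a mpoly poly" where
  "line_poly P f = peval (\<lambda>c. [:Cst c:]) (\<lambda>i. [:Var i, Cst (P i):]) f"

text \<open>A monomial of degree \<open>d\<close> becomes a product of \<open>d\<close> linear
  factors, whose top coefficients multiply to its value at \<open>P\<close>. A direction
  \<open>P\<close> off the hypersurface therefore gives degree exactly \<open>d\<close>.\<close>

lemma line_poly_degree:
  assumes "form n d f"
  shows "Polynomial.degree (line_poly P f) \<le> d"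
    and "Polynomial.coeff (line_poly P f) d = Cst (peval id P f)"
proof -
  interpret C: comm_ring_hom Cst by (rule comm_ring_hom_Cst)
  have *: "Polynomial.degree (mval (\<lambda>i. [:Var i, Cst (P i):]) m) \<le> d \<and>
      Polynomial.coeff (mval (\<lambda>i. [:Var i, Cst (P i):]) m) d = Cst (mval P m)"
    if "m \<in> Poly_Mapping.keys f" for m
  proof -
    have d: "d = (\<Sum>i\<in>Poly_Mapping.keys m. Poly_Mapping.lookup m i * 1)"
      using assms that by (auto simp: form_def)
    have e: "Polynomial.degree [:Var i, Cst (P i):] \<le> 1" for i by simp
    show ?thesis
      unfolding d mval_def C.hom_prod C.hom_power
      using degree_prod_coeff[of "Poly_Mapping.keys m" "\<lambda>i. [:Var i, Cst (P i):] ^ Poly_Mapping.lookup m i"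
          "\<lambda>i. Poly_Mapping.lookup m i * 1"] degree_power_coeff[OF e] by simp
  qed
  show "Polynomial.degree (line_poly P f) \<le> d"
    unfolding line_poly_def peval_def
    using * by (intro degree_sum_le) (auto intro: order_trans[OF degree_smult_le])
  show "Polynomial.coeff (line_poly P f) d = Cst (peval id P f)"
    unfolding line_poly_def peval_def C.hom_sum C.hom_mult coeff_sum
    using * by (intro sum.cong) auto
qed

lemma comm_ring_hom_poly_map_poly:
  assumes "comm_ring_hom \<psi>"
  shows "comm_ring_hom (\<lambda>p. Polynomial.poly (map_poly \<psi> p) t)"
proof -
  interpret psi: comm_ring_hom \<psi> by fact
  interpret map_poly_comm_ring_hom \<psi> ..
  show ?thesis by (rule comm_ring_hom_comp[OF comm_ring_hom_poly comm_ring_hom_axioms])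
qed

text \<open>The generic point is specialized by \<open>\<psi>\<close> while the parameter takes the
  value \<open>t\<close>. This is applied to a point, to a first-order displacement of that point,
  and to the identity.\<close>

lemma poly_line_poly:
  assumes "comm_ring_hom \<psi>" and "\<And>c. \<psi> (Cst c) = \<phi> c"
  shows "Polynomial.poly (map_poly \<psi> (line_poly P f)) t = peval \<phi> (\<lambda>i. \<psi> (Var i) + t * \<phi> (P i)) f"
proof -
  interpret psi: comm_ring_hom \<psi> by fact
  interpret M: comm_ring_hom "\<lambda>p. Polynomial.poly (map_poly \<psi> p) t"
    by (rule comm_ring_hom_poly_map_poly) fact
  show ?thesis unfolding line_poly_def M.hom_peval
    by (simp add: assms(2) hom_distribs)
qed

text \<open>Taylor expansion along one coordinate axis. It ties the formal derivative to a linear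
  coefficient, so that the Leibniz rule comes from multiplying univariate polynomials.\<close>

lemma first_order_expansion:
  fixes f :: "'a::idom mpoly" and v :: "nat \<Rightarrow> 'a" and i :: nat
  defines "p \<equiv> peval (\<lambda>c. [:c:]) (\<lambda>k. [:v k, if k = i then 1 else 0:]) f"
  shows "Polynomial.coeff p 0 = peval id v f"
    and "Polynomial.coeff p 1 = peval id v (partial_deriv i f)"
proof -
  interpret id: comm_ring_hom "id :: 'a \<Rightarrow> 'a" by (rule comm_ring_hom_id)
  interpret C: comm_ring_hom "\<lambda>c::'a. [:c:]" by (rule comm_ring_hom_const_poly)
  show "Polynomial.coeff p 0 = peval id v f"
    unfolding poly_0_coeff_0[symmetric] p_def comm_ring_hom.hom_peval[OF comm_ring_hom_poly] by (simp add: peval_def)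
  have *: "Polynomial.coeff (mval (\<lambda>k. [:v k, if k = i then 1 else 0:]) m) 1
      = of_nat (Poly_Mapping.lookup m i) * mval v (m - Poly_Mapping.single i 1)" for m
  proof -
    define m\<^sub>0 where "m\<^sub>0 = m - Poly_Mapping.single i (Poly_Mapping.lookup m i)"
    define k where "k = Poly_Mapping.lookup m i"
    have m: "m = m\<^sub>0 + Poly_Mapping.single i k"
      by (rule poly_mapping_eqI) (auto simp: m\<^sub>0_def k_def lookup_add lookup_minus lookup_single when_def)
    have m0: "i \<notin> Poly_Mapping.keys m\<^sub>0" by (simp add: m\<^sub>0_def in_keys_iff lookup_minus)
    have "mval (\<lambda>k. [:v k, if k = i then 1 else 0:]) m\<^sub>0 = mval (\<lambda>k. [:v k:]) m\<^sub>0"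
      using m0 by (intro mval_cong) auto
    also have "\<dots> = [:mval v m\<^sub>0:]" by (simp add: C.hom_mval)
    finally have e: "mval (\<lambda>k. [:v k, if k = i then 1 else 0:]) m = Polynomial.smult (mval v m\<^sub>0) ([:v i, 1:] ^ k)"
      unfolding m by (simp add: mval_add)
    have "Polynomial.coeff ([:v i, 1:] ^ k) 1 = of_nat k * v i ^ (k - 1)"
    proof -
      have "Polynomial.coeff ([:v i, 1:] ^ k) 1 = Polynomial.poly (pderiv ([:v i, 1:] ^ k)) 0"
        by (simp add: poly_0_coeff_0 coeff_pderiv)
      also have "\<dots> = of_nat k * v i ^ (k - 1)"
        by (cases k) (simp_all add: pderiv_power_Suc pderiv_pCons del: power_Suc)
      finally show ?thesis .
    qed
    \<comment> \<open>Truncation of the exponent matters only for \<open>k = 0\<close>, and there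
      the factor \<open>of_nat k\<close> is 0.\<close>
    moreover have "m - Poly_Mapping.single i 1 = m\<^sub>0 + Poly_Mapping.single i (k - 1)" if "k > 0"
      using that unfolding m
      by (intro poly_mapping_eqI) (auto simp: lookup_add lookup_minus lookup_single when_def)
    ultimately show ?thesis unfolding e by (cases "k = 0") (auto simp: mval_add k_def)
  qed
  have "peval id v (partial_deriv i f) = (\<Sum>m\<in>Poly_Mapping.keys f.
      of_nat (Poly_Mapping.lookup m i) * Poly_Mapping.lookup f m * mval v (m - Poly_Mapping.single i 1))"
    unfolding partial_deriv_def id.peval_sum id.peval_single by simp
  also have "\<dots> = Polynomial.coeff p 1"
    unfolding p_def peval_def coeff_sum by (intro sum.cong) (auto simp: *[simplified] mult_ac)
  finally show "Polynomial.coeff p 1 = peval id v (partial_deriv i f)" by simp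
qed

text \<open>Let \<open>G\<close> be the common part of the restrictions \<open>F = G F\<^sub>1\<close> and \<open>H = G H\<^sub>1\<close> of \<open>f\<close> and \<open>h\<close> to
  a generic line. If \<open>F\<^sub>1\<close> had a root, then \<open>H\<close>, but not \<open>H\<^sub>1\<close>, would vanish there, so \<open>G\<close> and \<open>F\<^sub>1\<close>
  would both vanish and the point would be singular.\<close>

theorem smooth_form_vanishing:
  fixes f h :: "'k::alg_closed_field mpoly"
  assumes n: "n \<ge> 1" and d: "d \<ge> 1" and f: "form n d f" "f \<noteq> 0" and h: "form n d h"
    and smooth: "\<And>x. \<exists>i\<le>n. x i \<noteq> 0 \<Longrightarrow> peval id x f = 0 \<Longrightarrow> \<exists>i\<le>n. peval id x (partial_deriv i f) \<noteq> 0"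
    and vanish: "\<And>x. \<exists>i\<le>n. x i \<noteq> 0 \<Longrightarrow> peval id x f = 0 \<Longrightarrow> peval id x h = 0"
  shows "\<exists>c. h = Cst c * f"
proof -
  interpret id: comm_ring_hom "id :: 'k \<Rightarrow> 'k" by (rule comm_ring_hom_id)
  interpret C: comm_ring_hom "\<lambda>c::'k. [:c:]" by (rule comm_ring_hom_const_poly)
  interpret Cst: comm_ring_hom "Cst :: 'k \<Rightarrow> 'k mpoly" by (rule comm_ring_hom_Cst)
  obtain P where P: "peval id P f \<noteq> 0" using exists_nonzero_value[OF infinite_UNIV_alg_closed f(2)] by blast
  \<comment> \<open>A form of positive degree vanishes at the origin, so \<open>P\<close> has a
    nonzero coordinate among the first \<open>n + 1\<close>.\<close>
  have "\<exists>j\<le>n. P j \<noteq> 0"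
  proof (rule ccontr)
    assume "\<not> ?thesis"
    then have "peval id P f = peval id (\<lambda>_. 0) f" by (intro peval_cong[OF f(1)]) auto
    also have "\<dots> = 0"
      unfolding peval_def
    proof (intro sum.neutral ballI)
      fix m assume "m \<in> Poly_Mapping.keys f"
      then have "mdeg m \<ge> 1" using f d by (auto simp: form_iff)
      then obtain i where "i \<in> Poly_Mapping.keys m" by (metis ex_in_conv keys_eq_empty mdeg_0 not_one_le_zero)
      then have "mval (\<lambda>_. 0::'k) m = 0"
        unfolding mval_def by (subst prod_zero_iff) (auto simp: in_keys_iff intro!: bexI[of _ i])
      then show "id (Poly_Mapping.lookup f m) * mval (\<lambda>_. 0) m = 0" by simp
    qed
    finally show False using P by simp
  qed
  then obtain j where j: "j \<le> n" "P j \<noteq> 0" by blast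
  obtain i where i: "i \<le> n" "i \<noteq> j" using n by (metis le0 zero_neq_one)
  define F where "F = line_poly P f"
  define H where "H = line_poly P h"
  have F: "Polynomial.degree F \<le> d" "Polynomial.coeff F d = Cst (peval id P f)"
    and H: "Polynomial.degree H \<le> d" "Polynomial.coeff H d = Cst (peval id P h)"
    unfolding F_def H_def using f h line_poly_degree by blast+
  have "Polynomial.coeff F d \<noteq> 0" using F P by simp
  then have F0: "F \<noteq> 0" and dF: "Polynomial.degree F = d"
    using le_antisym[OF F(1) le_degree] by auto
  obtain c c' r G F\<^sub>1 H\<^sub>1 a b where bez: "c \<noteq> 0" "c' \<noteq> 0" "r \<noteq> 0"
      "Polynomial.smult c F = G * F\<^sub>1" "Polynomial.smult c' H = G * H\<^sub>1" "a * F\<^sub>1 + b * H\<^sub>1 = [:r:]"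
    using pseudo_bezout[OF F0, of H] by blast
  have F\<^sub>1: "F\<^sub>1 \<noteq> 0" using bez(1,4) F0 by auto
  have "Polynomial.degree F\<^sub>1 = 0"
  proof (rule ccontr)
    assume deg: "Polynomial.degree F\<^sub>1 \<noteq> 0"
    \<comment> \<open>A 2 by 2 minor of the matrix with rows \<open>x\<close> and \<open>P\<close>.
      Where it is nonzero, the line through \<open>x\<close> in direction \<open>P\<close> misses
      the origin, so each of its points is a projective point.\<close>
    define \<Delta> where "\<Delta> = Var i * Cst (P j) - Var j * Cst (P i)"
    have "Poly_Mapping.lookup \<Delta> (Poly_Mapping.single i 1) = P j"
      using i unfolding \<Delta>_def mult.commute[of "Var _"] lookup_minus lookup_Cst_mult
      by (auto simp: Var_def lookup_single when_def dest: arg_cong[of _ _ "\<lambda>m. Poly_Mapping.lookup m i"])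
    then have "c * c' * r * Polynomial.lead_coeff F\<^sub>1 * \<Delta> \<noteq> 0"
      using bez F\<^sub>1 j by auto
    \<comment> \<open>One nonvanishing product makes \<open>x\<close> generic in all required ways:
      \<open>F\<^sub>1\<close> keeps its degree, \<open>c\<close> and \<open>r\<close> stay nonzero,
      and the line avoids the origin.\<close>
    then obtain x where x: "peval id x (c * c' * r * Polynomial.lead_coeff F\<^sub>1 * \<Delta>) \<noteq> 0"
      using exists_nonzero_value[OF infinite_UNIV_alg_closed] by blast
    define E where "E = peval id x"
    interpret E: comm_ring_hom E unfolding E_def by (rule id.comm_ring_hom_peval)
    have nz: "E c \<noteq> 0" "E r \<noteq> 0" "E (Polynomial.lead_coeff F\<^sub>1) \<noteq> 0" "E \<Delta> \<noteq> 0"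
      using x unfolding E_def[symmetric] E.hom_mult by auto
    have "Polynomial.degree (map_poly E F\<^sub>1) \<ge> Polynomial.degree F\<^sub>1"
      using nz by (intro le_degree) (simp add: coeff_map_poly)
    then obtain t where t: "Polynomial.poly (map_poly E F\<^sub>1) t = 0"
      using deg alg_closed_imp_poly_has_root by (metis gr0I le_zero_eq)
    interpret Et: comm_ring_hom "\<lambda>p. Polynomial.poly (map_poly E p) t"
      by (rule comm_ring_hom_poly_map_poly) (rule E.comm_ring_hom_axioms)
    define v where "v k = x k + t * P k" for k
    have ECst: "E (Cst e) = e" and EVar: "E (Var k) = x k" for e k
      unfolding E_def id.peval_Cst id.peval_Var by simp_all
    have "\<exists>k\<le>n. v k \<noteq> 0"
    proof (rule ccontr)
      assume "\<not> ?thesis"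
      then have "x i = - (t * P i)" "x j = - (t * P j)"
        using i j by (auto simp: v_def eq_neg_iff_add_eq_0)
      then have "E \<Delta> = 0" unfolding \<Delta>_def E.hom_minus E.hom_mult ECst EVar by simp
      then show False using nz by simp
    qed
    note v0 = this
    have line: "Polynomial.poly (map_poly E (line_poly P g)) t = peval id v g" for g
      unfolding v_def by (subst poly_line_poly[OF E.comm_ring_hom_axioms, of id]) (simp_all add: ECst EVar)
    have smult: "Polynomial.poly (map_poly E (Polynomial.smult e p)) t = E e * Polynomial.poly (map_poly E p) t" for e p
      using Et.hom_mult[of "[:e:]" p] by (simp add: hom_distribs)
    have "E c * peval id v f = 0"
      using arg_cong[OF bez(4), of "\<lambda>p. Polynomial.poly (map_poly E p) t"]
      unfolding smult Et.hom_mult F_def line t by simp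
    then have fv: "peval id v f = 0" using nz by simp
    then have hv: "peval id v h = 0" using vanish v0 by blast
    \<comment> \<open>At the root, \<open>G H\<^sub>1\<close> vanishes with \<open>H\<close>, but
      \<open>H\<^sub>1\<close> does not, because \<open>b H\<^sub>1\<close> specializes to the
      nonzero \<open>E r\<close>. Hence \<open>G\<close> vanishes.\<close>
    have "Polynomial.poly (map_poly E G) t * Polynomial.poly (map_poly E H\<^sub>1) t = 0"
      using arg_cong[OF bez(5), of "\<lambda>p. Polynomial.poly (map_poly E p) t"]
      unfolding smult Et.hom_mult H_def line hv by simp
    moreover have "Polynomial.poly (map_poly E b) t * Polynomial.poly (map_poly E H\<^sub>1) t = E r"
      using arg_cong[OF bez(6), of "\<lambda>p. Polynomial.poly (map_poly E p) t"]
      unfolding Et.hom_mult Et.hom_add t by (simp add: hom_distribs)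
    ultimately have Gt: "Polynomial.poly (map_poly E G) t = 0" using nz(2) by auto
    have "peval id v (partial_deriv l f) = 0" for l
    proof -
      \<comment> \<open>Displaces \<open>x\<close> along the axis \<open>l\<close>, the polynomial
        variable being the displacement. By \<open>psi0\<close> and \<open>e0\<close>, constant
        terms give back the specialization at \<open>x\<close>.\<close>
      define \<psi> where "\<psi> = peval (\<lambda>c. [:c:]) (\<lambda>k. [:x k, if k = l then 1 else 0:])"
      interpret psi: comm_ring_hom \<psi> unfolding \<psi>_def by (rule C.comm_ring_hom_peval)
      let ?e = "\<lambda>p. Polynomial.poly (map_poly \<psi> p) [:t:]"
      interpret psit: comm_ring_hom ?e
        by (rule comm_ring_hom_poly_map_poly) (rule psi.comm_ring_hom_axioms)
      have psi0: "Polynomial.coeff (\<psi> g) 0 = E g" for g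
        unfolding \<psi>_def E_def by (rule first_order_expansion)
      have e0: "Polynomial.coeff (?e p) 0 = Polynomial.poly (map_poly E p) t" for p
        by (induction p) (simp_all add: psi.hom_zero E.hom_zero hom_distribs psi0)
      have "?e F = peval (\<lambda>c. [:c:]) (\<lambda>k. [:v k, if k = l then 1 else 0:]) f"
        unfolding F_def v_def
        by (subst poly_line_poly[OF psi.comm_ring_hom_axioms, of "\<lambda>c. [:c:]"])
           (simp_all add: \<psi>_def C.peval_Cst C.peval_Var mult.commute)
      then have eF: "Polynomial.coeff (?e F) 0 = 0" "Polynomial.coeff (?e F) 1 = peval id v (partial_deriv l f)"
        using fv by (simp_all only: first_order_expansion)
      have mult1: "Polynomial.coeff (p * q) 1 = Polynomial.coeff p 0 * Polynomial.coeff q 1 + Polynomial.coeff p 1 * Polynomial.coeff q 0"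
        for p q :: "'k poly" by (simp add: coeff_mult)
      \<comment> \<open>Both factors on the right have constant term 0, so their product has no
        linear term. On the left the linear term is \<open>E c\<close> times the derivative, because
        \<open>f\<close> vanishes at \<open>v\<close>.\<close>
      have "\<psi> c * ?e F = ?e G * ?e F\<^sub>1"
        using arg_cong[OF bez(4), of ?e] psit.hom_mult[of "[:c:]" F]
        unfolding psit.hom_mult by (simp add: hom_distribs psi.hom_zero)
      from arg_cong[OF this, of "\<lambda>p. Polynomial.coeff p 1"]
      show ?thesis
        using nz(1) unfolding mult1 e0[of G] e0[of F\<^sub>1] Gt t eF psi0 by simp
    qed
    then show False using smooth[OF v0 fv] by simp
  qed
  then obtain e where e: "F\<^sub>1 = [:e:]" by (metis degree_eq_zeroE)
  have e0: "e \<noteq> 0" using F\<^sub>1 e by auto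
  have "Polynomial.smult (e * c') H = [:e:] * (G * H\<^sub>1)"
    using bez(5) by (simp flip: smult_smult)
  also have "\<dots> = Polynomial.smult c F * H\<^sub>1" unfolding bez(4) e by simp
  finally have eq: "Polynomial.smult (e * c') H = F * Polynomial.smult c H\<^sub>1" by simp
  \<comment> \<open>\<open>H\<close> has degree at most \<open>d\<close>, the degree of
    \<open>F\<close>, so the quotient \<open>c H\<^sub>1\<close> is constant in the
    parameter.\<close>
  obtain w where w: "Polynomial.smult c H\<^sub>1 = [:w:]"
  proof (cases "Polynomial.smult c H\<^sub>1 = 0")
    case False
    then have "Polynomial.degree (Polynomial.smult (e * c') H) = d + Polynomial.degree (Polynomial.smult c H\<^sub>1)"
      unfolding eq by (subst degree_mult_eq) (use F0 dF in auto)
    then have "Polynomial.degree (Polynomial.smult c H\<^sub>1) = 0"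
      using H(1) e0 bez(2) by simp
    then show ?thesis using that by (metis degree_eq_zeroE)
  qed (use that[of 0] in simp)
  have eq: "Polynomial.smult (e * c') H = Polynomial.smult w F" using eq unfolding w by simp
  \<comment> \<open>\<open>e * c'\<close> and \<open>w\<close> are still polynomials in the
    coordinates. Comparing coefficients at degree \<open>d\<close> in the parameter shows that their
    ratio is a scalar.\<close>
  have coeff: "e * c' * Cst (peval id P h) = w * Cst (peval id P f)"
    using arg_cong[OF eq, of "\<lambda>p. Polynomial.coeff p d"] F(2) H(2) by simp
  \<comment> \<open>Parameter 0 leads back to the generic point and turns the relation between
    \<open>H\<close> and \<open>F\<close> into one between \<open>h\<close> and
    \<open>f\<close>.\<close>
  have at0: "Polynomial.poly (line_poly P g) 0 = g" for g
    using poly_line_poly[of id Cst P g 0] comm_ring_hom_id by (simp add: peval_Cst_Var)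
  have "e * c' * h = w * f"
    using arg_cong[OF eq, of "\<lambda>p. Polynomial.poly p 0"] unfolding F_def H_def by (simp add: at0)
  then have "e * c' * (Cst (peval id P f) * h) = w * Cst (peval id P f) * f" by (simp add: mult_ac)
  also have "\<dots> = e * c' * (Cst (peval id P h) * f)" unfolding coeff[symmetric] by (simp add: mult_ac)
  finally have *: "Cst (peval id P f) * h = Cst (peval id P h) * f" using e0 bez(2) by simp
  have "h = Cst (inverse (peval id P f)) * (Cst (peval id P f) * h)"
    using P by (simp add: Cst_1 mult.assoc[symmetric] flip: Cst_mult)
  then show ?thesis unfolding * by (metis Cst_mult mult.assoc)
qed

section \<open>Linear substitutions\<close>

definition lin_form :: "nat \<Rightarrow> 'a::comm_ring_1 mat \<Rightarrow> nat \<Rightarrow> 'a mpoly" where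
  "lin_form n A k = (\<Sum>l\<le>n. Cst (A $$ (k, l)) * Var l)"

definition lin_subst :: "nat \<Rightarrow> 'a::comm_ring_1 mat \<Rightarrow> 'a mpoly \<Rightarrow> 'a mpoly" where
  "lin_subst n A f = peval Cst (lin_form n A) f"

lemma form_lin_subst: "form n d f \<Longrightarrow> form n d (lin_subst n A f)"
  unfolding lin_subst_def
  by (rule form_peval) (auto simp: lin_form_def intro!: form_sum form_Cst_mult form_Var[simplified])

lemma (in comm_ring_hom) peval_lin_subst:
  "peval hom v (lin_subst n A f) = peval hom (\<lambda>k. \<Sum>l\<le>n. hom (A $$ (k, l)) * v l) f"
proof -
  interpret E: comm_ring_hom "peval hom v" by (rule comm_ring_hom_peval)
  show ?thesis
    unfolding lin_subst_def lin_form_def E.hom_peval E.hom_sum E.hom_mult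
    by (simp add: peval_Cst peval_Var)
qed

lemma comm_ring_hom_lin_subst: "comm_ring_hom (lin_subst n A)"
  unfolding lin_subst_def by (rule comm_ring_hom.comm_ring_hom_peval[OF comm_ring_hom_Cst])

lemma lin_subst_Cst: "lin_subst n A (Cst c) = Cst c"
  unfolding lin_subst_def by (rule comm_ring_hom.peval_Cst[OF comm_ring_hom_Cst])

text \<open>Substitution is composition on the right with the linear map of the matrix, so the order
  of the factors is reversed.\<close>

lemma lin_subst_lin_subst:
  assumes f: "form n d f" and A: "A \<in> carrier_mat (n + 1) (n + 1)" and B: "B \<in> carrier_mat (n + 1) (n + 1)"
  shows "lin_subst n A (lin_subst n B f) = lin_subst n (B * A) f"
proof -
  interpret C: comm_ring_hom "Cst :: 'a \<Rightarrow> 'a mpoly" by (rule comm_ring_hom_Cst)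
  have "(\<Sum>l\<le>n. Cst (B $$ (k, l)) * lin_form n A l) = lin_form n (B * A) k" if k: "k \<le> n" for k
  proof -
    have "(B * A) $$ (k, s) = (\<Sum>l\<le>n. B $$ (k, l) * A $$ (l, s))" if "s \<le> n" for s
      using A B k that by (simp add: scalar_prod_def atLeast0LessThan lessThan_Suc_atMost)
    then have "lin_form n (B * A) k = (\<Sum>s\<le>n. \<Sum>l\<le>n. Cst (B $$ (k, l)) * (Cst (A $$ (l, s)) * Var s))"
      unfolding lin_form_def by (intro sum.cong) (auto simp: C.hom_sum C.hom_mult sum_distrib_right mult.assoc)
    also have "\<dots> = (\<Sum>l\<le>n. Cst (B $$ (k, l)) * lin_form n A l)"
      unfolding lin_form_def sum_distrib_left by (rule sum.swap)
    finally show ?thesis ..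
  qed
  then show ?thesis
    unfolding lin_subst_def[of n A] C.peval_lin_subst by (subst lin_subst_def, intro peval_cong[OF f]) auto
qed

lemma lin_subst_one:
  assumes "form n d f"
  shows "lin_subst n (1\<^sub>m (n + 1)) f = f"
proof -
  have "lin_form n (1\<^sub>m (n + 1)) k = (Var k :: 'a mpoly)" if "k \<le> n" for k
  proof -
    have "lin_form n (1\<^sub>m (n + 1)) k = (\<Sum>l\<le>n. if l = k then Var l else (0 :: 'a mpoly))"
      unfolding lin_form_def using that by (intro sum.cong) (auto simp: Cst_1)
    then show ?thesis using that by simp
  qed
  then have "lin_subst n (1\<^sub>m (n + 1)) f = peval Cst Var f"
    unfolding lin_subst_def by (intro peval_cong[OF assms])
  then show ?thesis by (simp add: peval_Cst_Var)
qed

lemma lin_subst_inj: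
  assumes "form n d f" "form n d g" "lin_subst n A f = lin_subst n A g"
    "A \<in> carrier_mat (n + 1) (n + 1)" "B \<in> carrier_mat (n + 1) (n + 1)" "A * B = 1\<^sub>m (n + 1)"
  shows "f = g"
  using assms lin_subst_lin_subst[of n d _ B A] by (metis lin_subst_one)

section \<open>Counting monomials and forms\<close>

definition monomials :: "nat \<Rightarrow> nat \<Rightarrow> (nat \<Rightarrow>\<^sub>0 nat) set" where
  "monomials n d = {m. Poly_Mapping.keys m \<subseteq> {..n} \<and> mdeg m = d}"

lemma form_iff_keys: "form n d f \<longleftrightarrow> Poly_Mapping.keys f \<subseteq> monomials n d"
  by (auto simp: form_iff monomials_def)

text \<open>Exponent vectors written as lists make the count of monomials a stars-and-bars
  count.\<close>

lemma bij_betw_monomials: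
  "bij_betw (\<lambda>m. map (Poly_Mapping.lookup m) [0..<n + 1]) (monomials n d)
     {l. length l = n + 1 \<and> sum_list l = d}"
proof (rule bij_betw_imageI)
  show "inj_on (\<lambda>m. map (Poly_Mapping.lookup m) [0..<n + 1]) (monomials n d)"
  proof (rule inj_onI, rule poly_mapping_eqI)
    fix m m' i
    assume m: "m \<in> monomials n d" "m' \<in> monomials n d"
      and eq: "map (Poly_Mapping.lookup m) [0..<n + 1] = map (Poly_Mapping.lookup m') [0..<n + 1]"
    show "Poly_Mapping.lookup m i = Poly_Mapping.lookup m' i"
    proof (cases "i \<le> n")
      case True
      then show ?thesis using eq by (auto simp del: upt_Suc)
    next
      case False
      then have "i \<notin> Poly_Mapping.keys m" "i \<notin> Poly_Mapping.keys m'" using m by (auto simp: monomials_def)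
      then show ?thesis by (simp add: in_keys_iff)
    qed
  qed
  have sum: "mdeg m = sum_list (map (Poly_Mapping.lookup m) [0..<n + 1])" if "Poly_Mapping.keys m \<subseteq> {..n}" for m
    using that by (subst mdeg_superset[of "{..n}"])
      (auto simp: sum_list_distinct_conv_sum_set lessThan_Suc_atMost atLeast0LessThan simp del: upt_Suc)
  show "(\<lambda>m. map (Poly_Mapping.lookup m) [0..<n + 1]) ` monomials n d = {l. length l = n + 1 \<and> sum_list l = d}"
  proof (intro equalityI subsetI)
    fix l :: "nat list" assume l: "l \<in> {l. length l = n + 1 \<and> sum_list l = d}"
    define m where "m = (\<Sum>i\<le>n. Poly_Mapping.single i (l ! i))"
    have lm: "Poly_Mapping.lookup m i = (if i \<le> n then l ! i else 0)" for i
      by (simp add: m_def lookup_sum lookup_single when_def)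
    then have k: "Poly_Mapping.keys m \<subseteq> {..n}" by (auto simp: in_keys_iff split: if_splits)
    have ml: "map (Poly_Mapping.lookup m) [0..<n + 1] = l"
      using l by (intro nth_equalityI) (auto simp: lm simp del: upt_Suc)
    then have "m \<in> monomials n d" using k l sum[OF k] by (simp add: monomials_def)
    then show "l \<in> (\<lambda>m. map (Poly_Mapping.lookup m) [0..<n + 1]) ` monomials n d" using ml by force
  qed (use sum in \<open>auto simp: monomials_def simp del: upt_Suc\<close>)
qed

lemma card_monomials: "card (monomials n d) = (n + d) choose d"
  using bij_betw_same_card[OF bij_betw_monomials[of n d]] card_length_sum_list[of "n + 1" d]
  by (simp add: add.commute)

lemma finite_monomials [simp]: "finite (monomials n d)"
  by (rule card_ge_0_finite) (simp add: card_monomials)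

lemma supported_forms:
  assumes "finite B"
  shows "finite {f :: 'a::{comm_monoid_add,finite} mpoly. Poly_Mapping.keys f \<subseteq> B}"
    and "card {f :: 'a::{comm_monoid_add,finite} mpoly. Poly_Mapping.keys f \<subseteq> B} = CARD('a) ^ card B"
proof -
  have "bij_betw (\<lambda>f. restrict (Poly_Mapping.lookup f) B) {f :: 'a mpoly. Poly_Mapping.keys f \<subseteq> B} (B \<rightarrow>\<^sub>E UNIV)"
  proof (rule bij_betw_imageI)
    show "inj_on (\<lambda>f. restrict (Poly_Mapping.lookup f) B) {f :: 'a mpoly. Poly_Mapping.keys f \<subseteq> B}"
    proof (rule inj_onI, rule poly_mapping_eqI)
      fix f g :: "'a mpoly" and m
      assume fg: "f \<in> {f. Poly_Mapping.keys f \<subseteq> B}" "g \<in> {f. Poly_Mapping.keys f \<subseteq> B}"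
        and eq: "restrict (Poly_Mapping.lookup f) B = restrict (Poly_Mapping.lookup g) B"
      show "Poly_Mapping.lookup f m = Poly_Mapping.lookup g m"
      proof (cases "m \<in> B")
        case True then show ?thesis using fun_cong[OF eq, of m] by simp
      next
        case False
        then have "m \<notin> Poly_Mapping.keys f" "m \<notin> Poly_Mapping.keys g" using fg by auto
        then show ?thesis by (simp add: in_keys_iff)
      qed
    qed
    show "(\<lambda>f. restrict (Poly_Mapping.lookup f) B) ` {f :: 'a mpoly. Poly_Mapping.keys f \<subseteq> B} = (B \<rightarrow>\<^sub>E UNIV)"
    proof (intro equalityI subsetI)
      fix h :: "(nat \<Rightarrow>\<^sub>0 nat) \<Rightarrow> 'a" assume h: "h \<in> B \<rightarrow>\<^sub>E UNIV"
      define f where "f = (\<Sum>m\<in>B. Poly_Mapping.single m (h m))"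
      have lf: "Poly_Mapping.lookup f m = (if m \<in> B then h m else 0)" for m
        using assms by (simp add: f_def lookup_sum lookup_single when_def)
      then have "Poly_Mapping.keys f \<subseteq> B" by (auto simp: in_keys_iff split: if_splits)
      moreover have "h = restrict (Poly_Mapping.lookup f) B" using h by (auto simp: lf fun_eq_iff PiE_def extensional_def)
      ultimately show "h \<in> (\<lambda>f. restrict (Poly_Mapping.lookup f) B) ` {f :: 'a mpoly. Poly_Mapping.keys f \<subseteq> B}" by blast
    qed auto
  qed
  moreover have "card (B \<rightarrow>\<^sub>E (UNIV :: 'a set)) = CARD('a) ^ card B" by (rule card_funcsetE[OF assms])
  moreover have "finite (B \<rightarrow>\<^sub>E (UNIV :: 'a set))" by (intro finite_PiE assms) simp
  ultimately show "finite {f :: 'a mpoly. Poly_Mapping.keys f \<subseteq> B}"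
    "card {f :: 'a mpoly. Poly_Mapping.keys f \<subseteq> B} = CARD('a) ^ card B"
    using bij_betw_finite bij_betw_same_card by metis+
qed

lemma mdeg_eq_0_iff: "mdeg m = 0 \<longleftrightarrow> m = 0"
  by (metis finite_keys in_keys_iff keys_eq_empty mdeg_0 mdeg_def sum_eq_0_iff ex_in_conv)

lemma lookup_split:
  assumes "a \<le> Poly_Mapping.lookup m i"
  shows "m = (m - Poly_Mapping.single i a) + Poly_Mapping.single i (a::nat)"
  using assms by (intro poly_mapping_eqI) (auto simp: lookup_add lookup_minus lookup_single when_def)

text \<open>Multiplication by \<open>x_i^a\<close> embeds the monomials of degree \<open>k\<close>.
  As \<open>k \<le> a\<close>, the only product that can violate the bound on the exponent of
  \<open>x_j\<close> is \<open>x_i^a x_j^a\<close>, which accounts for the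
  \<open>+ 1\<close>.\<close>

lemma card_monomials_le:
  assumes ij: "i \<le> n" "i \<noteq> j" and a: "k + a = d" "d \<le> 2 * a"
  shows "card (monomials n k) \<le> card {m \<in> monomials n d. a \<le> Poly_Mapping.lookup m i \<and> Poly_Mapping.lookup m j < a} + 1"
    (is "_ \<le> card ?B + 1")
proof -
  let ?m = "Poly_Mapping.single i a + Poly_Mapping.single j a"
  have "(\<lambda>m. m + Poly_Mapping.single i a) ` monomials n k \<subseteq> insert ?m ?B"
  proof (rule image_subsetI)
    fix m assume m: "m \<in> monomials n k"
    let ?p = "m + Poly_Mapping.single i a"
    have p: "?p \<in> monomials n d" "a \<le> Poly_Mapping.lookup ?p i"
      using m ij a by (auto simp: monomials_def keys_add_exponents mdeg_add lookup_add split: if_splits)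
    show "?p \<in> insert ?m ?B"
    proof (cases "Poly_Mapping.lookup ?p j < a")
      case False
      then have "a \<le> Poly_Mapping.lookup m j" using ij by (auto simp: lookup_add lookup_single when_def)
      then have s: "m = (m - Poly_Mapping.single j a) + Poly_Mapping.single j a" by (rule lookup_split)
      have "k = mdeg (m - Poly_Mapping.single j a) + a"
        using m arg_cong[OF s, of mdeg] by (simp add: monomials_def mdeg_add)
      then have "m - Poly_Mapping.single j a = 0" using a by (simp flip: mdeg_eq_0_iff)
      then show ?thesis using s by (simp add: add.commute)
    qed (use p in auto)
  qed
  then have "card ((\<lambda>m. m + Poly_Mapping.single i a) ` monomials n k) \<le> card (insert ?m ?B)"
    by (intro card_mono) auto
  also have "\<dots> \<le> card ?B + 1" by (simp add: card_insert_if)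
  finally show ?thesis by (subst (asm) card_image) (auto intro: inj_onI)
qed

text \<open>\<open>(n + d) choose n\<close> is the product of \<open>(t + d) / t\<close> for
  \<open>t\<close> from 1 to \<open>n\<close>, and \<open>t + d \<le> 2 * (t + k)\<close> for each
  such \<open>t\<close>.\<close>

lemma binomial_half:
  assumes "d \<le> 2 * k + 1"
  shows "(n + d) choose d \<le> 2 ^ n * ((n + k) choose k)"
proof -
  have sym: "(n + e) choose e = (n + e) choose n" for n e :: nat
    using binomial_symmetric[of e "n + e"] by simp
  have "(n + d) choose n \<le> 2 ^ n * ((n + k) choose n)"
  proof (induction n)
    case (Suc n)
    have "Suc n * ((Suc n + d) choose Suc n) = (Suc n + d) * ((n + d) choose n)"
      using Suc_times_binomial[of n "n + d"] by simp
    also have "\<dots> \<le> (2 * (Suc n + k)) * (2 ^ n * ((n + k) choose n))"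
      using Suc assms by (intro mult_le_mono) auto
    also have "\<dots> = 2 ^ Suc n * ((Suc n + k) * ((n + k) choose n))" by (simp only: power_Suc mult_ac)
    also have "(Suc n + k) * ((n + k) choose n) = Suc n * ((Suc n + k) choose Suc n)"
      using Suc_times_binomial[of n "n + k"] by simp
    finally have "Suc n * ((Suc n + d) choose Suc n) \<le> Suc n * (2 ^ Suc n * ((Suc n + k) choose Suc n))"
      by (simp only: mult_ac)
    then show ?case by (simp only: Suc_mult_le_cancel1)
  qed simp
  then show ?thesis by (simp only: sym[of n d] sym[of n k])
qed

section \<open>Semi-invariant forms\<close>

definition semi_invariants :: "nat \<Rightarrow> nat \<Rightarrow> 'a::comm_ring_1 mat \<Rightarrow> 'a \<Rightarrow> 'a mpoly set" where
  "semi_invariants n d A c = {f. form n d f \<and> lin_subst n A f = Cst c * f}"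

text \<open>If \<open>x\<^sub>i ^ a\<close> divides \<open>f\<close>, then \<open>l ^ a\<close> divides the transform of \<open>f\<close>, where \<open>l\<close> is the transform of
  \<open>x\<^sub>i\<close>; as \<open>x\<^sub>j\<close> occurs in \<open>l\<close>, the transform has degree at least \<open>a\<close> in \<open>x\<^sub>j\<close>.\<close>

lemma semi_invariant_eq_0:
  fixes f :: "'a::idom mpoly"
  assumes ij: "j \<le> n" "A $$ (i, j) \<noteq> 0" and c: "c \<noteq> 0" and inv: "lin_subst n A f = Cst c * f"
    and keys: "\<And>m. m \<in> Poly_Mapping.keys f \<Longrightarrow> a \<le> Poly_Mapping.lookup m i \<and> Poly_Mapping.lookup m j < a"
  shows "f = 0"
proof (rule ccontr)
  assume f0: "f \<noteq> 0"
  have hom: "comm_ring_hom (\<lambda>c::'a. [:Cst c:])"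
    by (rule comm_ring_hom_comp[OF comm_ring_hom_const_poly comm_ring_hom_Cst])
  interpret C: comm_ring_hom "\<lambda>c::'a. [:Cst c:]" by (rule hom)
  \<comment> \<open>A polynomial is now regarded as univariate in \<open>x_j\<close>, with the other
    variables in the coefficients; \<open>L k\<close> is the transform of \<open>x_k\<close> in this
    guise.\<close>
  define y where "y k = (if k = j then [:0, 1:] else [:Var k:] :: 'a mpoly poly)" for k
  define ev where "ev = peval (\<lambda>c. [:Cst c:]) y"
  define L where "L k = (\<Sum>l\<le>n. [:Cst (A $$ (k, l)):] * y l)" for k
  \<comment> \<open>Putting \<open>x_j\<close> back for the univariate variable returns
    \<open>f\<close>, so \<open>ev f\<close> cannot be 0.\<close>
  have "Polynomial.poly (ev f) (Var j) = peval Cst (\<lambda>k. Polynomial.poly (y k) (Var j)) f"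
    unfolding ev_def comm_ring_hom.hom_peval[OF comm_ring_hom_poly] by simp
  also have "(\<lambda>k. Polynomial.poly (y k) (Var j)) = Var" by (auto simp: y_def)
  finally have "Polynomial.poly (ev f) (Var j) = f" by (simp add: peval_Cst_Var)
  then have ev0: "ev f \<noteq> 0" using f0 by auto
  obtain m0 where "m0 \<in> Poly_Mapping.keys f" using f0 by (metis ex_in_conv keys_eq_empty)
  then have a0: "a > 0" using keys by fastforce
  have "ev (lin_subst n A f) = peval (\<lambda>c. [:Cst c:]) L f"
    unfolding ev_def C.peval_lin_subst L_def ..
  moreover have "ev (lin_subst n A f) = [:Cst c:] * ev f"
    unfolding inv ev_def C.peval_mult C.peval_Cst ..
  ultimately have "peval (\<lambda>c. [:Cst c:]) L f = [:Cst c:] * ev f" by simp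
  moreover have "L i ^ a dvd peval (\<lambda>c. [:Cst c:]) L f"
    unfolding peval_def
  proof (intro dvd_sum dvd_mult)
    fix m assume m: "m \<in> Poly_Mapping.keys f"
    then have "i \<in> Poly_Mapping.keys m" using keys[OF m] a0 by (auto simp: in_keys_iff)
    then have "L i ^ Poly_Mapping.lookup m i dvd mval L m" unfolding mval_def by (intro dvd_prodI) auto
    then show "L i ^ a dvd mval L m" using keys[OF m] by (meson dvd_trans le_imp_power_dvd)
  qed
  ultimately have "Polynomial.degree (L i ^ a) \<le> Polynomial.degree ([:Cst c:] * ev f)"
    using ev0 c by (intro dvd_imp_degree_le) auto
  moreover have "Polynomial.coeff (L i) 1 = (\<Sum>l\<le>n. if l = j then Cst (A $$ (i, l)) else 0)"
    unfolding L_def coeff_sum by (intro sum.cong) (auto simp: y_def)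
  then have L1: "Polynomial.coeff (L i) 1 \<noteq> 0" using ij by simp
  then have "L i \<noteq> 0" by auto
  ultimately have le: "a * Polynomial.degree (L i) \<le> Polynomial.degree (ev f)"
    using c by (simp add: degree_power_eq mult.commute)
  have "1 \<le> Polynomial.degree (L i)" using L1 by (rule le_degree)
  then have "a \<le> Polynomial.degree (ev f)" using le by (metis dual_order.trans mult.right_neutral mult_le_mono2)
  moreover have "Polynomial.degree (ev f) \<le> a - 1"
    unfolding ev_def peval_def
  proof (rule degree_sum_le)
    fix m assume m: "m \<in> Poly_Mapping.keys f"
    have "Polynomial.degree (mval y m) \<le> (\<Sum>k\<in>Poly_Mapping.keys m. if k = j then Poly_Mapping.lookup m j else 0)"
      unfolding mval_def
    proof (rule conjunct1[OF degree_prod_coeff])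
      fix k show "Polynomial.degree (y k ^ Poly_Mapping.lookup m k) \<le> (if k = j then Poly_Mapping.lookup m j else 0)"
        using degree_power_le[of "y k" "Poly_Mapping.lookup m k"] by (auto simp: y_def)
    qed simp
    also have "\<dots> \<le> a - 1" using keys[OF m] by (auto simp: sum.delta)
    finally show "Polynomial.degree ([:Cst (Poly_Mapping.lookup f m):] * mval y m) \<le> a - 1"
      using degree_smult_le[of "Cst (Poly_Mapping.lookup f m)" "mval y m"] by simp
  qed simp
  ultimately show False using a0 by simp
qed

lemma semi_invariants_diff:
  fixes A :: "'a::comm_ring_1 mat"
  assumes "f \<in> semi_invariants n d A c" "g \<in> semi_invariants n d A c"
  shows "f - g \<in> semi_invariants n d A c"
proof -
  interpret S: comm_ring_hom "lin_subst n A" by (rule comm_ring_hom_lin_subst)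
  show ?thesis using assms by (auto simp: semi_invariants_def form_diff S.hom_minus right_diff_distrib)
qed

lemma finite_semi_invariants: "finite (semi_invariants n d (A :: 'a::{comm_ring_1,finite} mat) c)"
  by (rule finite_subset[OF _ supported_forms(1)[OF finite_monomials[of n d]]])
     (auto simp: semi_invariants_def form_iff_keys)

text \<open>By \<open>semi_invariant_eq_0\<close> the semi-invariants meet the span of the monomials
  in \<open>?B\<close> only in 0, so sums of one form from each space are pairwise distinct forms of
  degree \<open>d\<close>.\<close>

lemma card_semi_invariants_off_diagonal:
  fixes A :: "'a::{field,finite} mat"
  assumes ij: "i \<le> n" "j \<le> n" "i \<noteq> j" "A $$ (i, j) \<noteq> 0" and c: "c \<noteq> 0" and a: "k + a = d" "d \<le> 2 * a"
  shows "card (semi_invariants n d A c) * CARD('a) ^ (((n + k) choose k) - 1) \<le> CARD('a) ^ ((n + d) choose d)"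
proof -
  let ?S = "semi_invariants n d A c"
  let ?B = "{m \<in> monomials n d. a \<le> Poly_Mapping.lookup m i \<and> Poly_Mapping.lookup m j < a}"
  let ?W = "{f :: 'a mpoly. Poly_Mapping.keys f \<subseteq> ?B}"
  have inj: "inj_on (\<lambda>(f, w). f + w) (?S \<times> ?W)"
  proof (rule inj_onI, clarsimp)
    fix f w f' w' :: "'a mpoly"
    assume f: "f \<in> ?S" "f' \<in> ?S" and w: "Poly_Mapping.keys w \<subseteq> ?B" "Poly_Mapping.keys w' \<subseteq> ?B" and eq: "f + w = f' + w'"
    have e: "f - f' = w' - w" using eq by (simp add: algebra_simps)
    have "Poly_Mapping.keys (f - f') \<subseteq> ?B" unfolding e using keys_diff[of w' w] w by blast
    moreover have "lin_subst n A (f - f') = Cst c * (f - f')"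
      using semi_invariants_diff[OF f] by (simp add: semi_invariants_def)
    ultimately have "f - f' = 0"
      using ij c by (intro semi_invariant_eq_0[of j n A i c _ a]) auto
    then show "f = f' \<and> w = w'" using e by simp
  qed
  have "(\<lambda>(f, w). f + w) ` (?S \<times> ?W) \<subseteq> {f. Poly_Mapping.keys f \<subseteq> monomials n d}"
    using keys_add by (fastforce simp: semi_invariants_def form_iff_keys)
  then have "card (?S \<times> ?W) \<le> CARD('a) ^ card (monomials n d)"
    using card_inj_on_le[OF inj _ supported_forms(1)[OF finite_monomials]]
    by (simp only: supported_forms(2)[OF finite_monomials])
  then have "card ?S * CARD('a) ^ card ?B \<le> CARD('a) ^ ((n + d) choose d)"
    by (simp add: card_cartesian_product supported_forms(2) card_monomials)
  moreover have "((n + k) choose k) - 1 \<le> card ?B"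
    using card_monomials_le[OF ij(1,3) a] by (simp add: card_monomials)
  then have "CARD('a) ^ (((n + k) choose k) - 1) \<le> CARD('a) ^ card ?B"
    by (intro power_increasing) (auto simp: Suc_le_eq)
  ultimately show ?thesis by (meson le_trans mult_le_mono2)
qed

text \<open>Composition with \<open>T\<close> carries semi-invariants of \<open>A\<close> to those
  of its conjugate by \<open>T\<close>, with the same eigenvalue, and \<open>T'\<close> makes it
  injective.\<close>

lemma card_semi_invariants_conjugate:
  fixes A :: "'a::{field,finite} mat"
  assumes mats: "A \<in> carrier_mat (n + 1) (n + 1)" "A' \<in> carrier_mat (n + 1) (n + 1)"
      "T \<in> carrier_mat (n + 1) (n + 1)" "T' \<in> carrier_mat (n + 1) (n + 1)"
    and T: "T * T' = 1\<^sub>m (n + 1)" "T * A' = A * T"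
  shows "card (semi_invariants n d A c) \<le> card (semi_invariants n d A' c)"
proof (rule card_inj_on_le)
  show "inj_on (lin_subst n T) (semi_invariants n d A c)"
    using lin_subst_inj[OF _ _ _ mats(3,4) T(1)] by (intro inj_onI) (auto simp: semi_invariants_def)
  show "lin_subst n T ` semi_invariants n d A c \<subseteq> semi_invariants n d A' c"
  proof (rule image_subsetI)
    fix f assume "f \<in> semi_invariants n d A c"
    then have f: "form n d f" "lin_subst n A f = Cst c * f" by (auto simp: semi_invariants_def)
    have "lin_subst n A' (lin_subst n T f) = lin_subst n T (lin_subst n A f)"
      unfolding lin_subst_lin_subst[OF f(1) mats(2,3)] lin_subst_lin_subst[OF f(1) mats(3,1)] T(2) ..
    also have "\<dots> = Cst c * lin_subst n T f"
      unfolding f(2) by (simp add: comm_ring_hom.peval_mult[OF comm_ring_hom_Cst] lin_subst_Cst[unfolded lin_subst_def] lin_subst_def)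
    finally show "lin_subst n T f \<in> semi_invariants n d A' c"
      using f by (simp add: semi_invariants_def form_lin_subst)
  qed
qed (rule finite_semi_invariants)

lemma card_semi_invariants:
  fixes A :: "'a::{field,finite} mat"
  assumes A: "A \<in> carrier_mat (n + 1) (n + 1)" "\<And>e. A \<noteq> e \<cdot>\<^sub>m 1\<^sub>m (n + 1)" and c: "c \<noteq> 0" and a: "k + a = d" "d \<le> 2 * a"
  shows "card (semi_invariants n d A c) * CARD('a) ^ (((n + k) choose k) - 1) \<le> CARD('a) ^ ((n + d) choose d)"
proof (cases "\<exists>i\<le>n. \<exists>j\<le>n. i \<noteq> j \<and> A $$ (i, j) \<noteq> 0")
  case True
  then obtain i j where "i \<le> n" "j \<le> n" "i \<noteq> j" "A $$ (i, j) \<noteq> 0" by auto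
  then show ?thesis by (rule card_semi_invariants_off_diagonal) (fact c a)+
next
  case False
  then have off: "A $$ (r, s) = 0" if "r \<le> n" "s \<le> n" "r \<noteq> s" for r s using that by blast
  have "\<exists>i\<le>n. A $$ (i, i) \<noteq> A $$ (0, 0)"
  proof (rule ccontr)
    assume "\<not> ?thesis"
    then obtain e where diag: "A $$ (r, r) = e" if "r \<le> n" for r by blast
    have "A = e \<cdot>\<^sub>m 1\<^sub>m (n + 1)"
      using A(1) by (intro eq_matI) (auto simp: diag off)
    then show False using A(2) by blast
  qed
  then obtain i where i: "i \<le> n" "A $$ (i, i) \<noteq> A $$ (0, 0)" by blast
  then have i0: "i \<noteq> 0" by metis
  \<comment> \<open>For a diagonal matrix with two different diagonal entries, conjugation by the
    elementary matrix \<open>E 1\<close> creates the nonzero off-diagonal entry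
    \<open>A $$ (i, i) - A $$ (0, 0)\<close>; \<open>A'\<close> is the result.\<close>
  define E :: "'a \<Rightarrow> 'a mat" where "E u = mat (n + 1) (n + 1) (\<lambda>(r, s). if r = s then 1 else if r = i \<and> s = 0 then u else 0)" for u
  define A' where "A' = mat (n + 1) (n + 1) (\<lambda>(r, s). if r = i \<and> s = 0 then A $$ (i, i) - A $$ (0, 0) else A $$ (r, s))"
  have Emult: "E u * M = mat (n + 1) (n + 1) (\<lambda>(r, s). M $$ (r, s) + (if r = i then u * M $$ (0, s) else 0))"
    if "M \<in> carrier_mat (n + 1) (n + 1)" for M u
  proof (rule eq_matI)
    fix r s assume "r < dim_row (mat (n + 1) (n + 1) (\<lambda>(r, s). M $$ (r, s) + (if r = i then u * M $$ (0, s) else 0)))"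
      "s < dim_col (mat (n + 1) (n + 1) (\<lambda>(r, s). M $$ (r, s) + (if r = i then u * M $$ (0, s) else 0)))"
    then have rs: "r < n + 1" "s < n + 1" by auto
    then have "(E u * M) $$ (r, s) = (\<Sum>l\<in>{0..<n + 1}. (if r = l then 1 else if r = i \<and> l = 0 then u else 0) * M $$ (l, s))"
      using that by (auto simp: E_def scalar_prod_def intro!: sum.cong)
    also have "\<dots> = (\<Sum>l\<in>{0..<n + 1}. (if l = r then M $$ (l, s) else 0) + (if l = 0 then (if r = i then u * M $$ (l, s) else 0) else 0))"
      using i0 by (intro sum.cong) auto
    also have "\<dots> = M $$ (r, s) + (if r = i then u * M $$ (0, s) else 0)"
      using rs by (simp add: sum.distrib)
    finally show "(E u * M) $$ (r, s) = mat (n + 1) (n + 1) (\<lambda>(r, s). M $$ (r, s) + (if r = i then u * M $$ (0, s) else 0)) $$ (r, s)"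
      using rs by simp
  qed (use that in \<open>auto simp: E_def\<close>)
  have AE: "A * E 1 = mat (n + 1) (n + 1) (\<lambda>(r, s). A $$ (r, r) * E 1 $$ (r, s))"
  proof (rule eq_matI)
    fix r s assume "r < dim_row (mat (n + 1) (n + 1) (\<lambda>(r, s). A $$ (r, r) * E 1 $$ (r, s)))"
      "s < dim_col (mat (n + 1) (n + 1) (\<lambda>(r, s). A $$ (r, r) * E 1 $$ (r, s)))"
    then have rs: "r < n + 1" "s < n + 1" by auto
    then have "(A * E 1) $$ (r, s) = (\<Sum>l\<in>{0..<n + 1}. A $$ (r, l) * E 1 $$ (l, s))"
      using A(1) by (auto simp: E_def scalar_prod_def intro!: sum.cong)
    also have "\<dots> = (\<Sum>l\<in>{0..<n + 1}. if l = r then A $$ (r, r) * E 1 $$ (r, s) else 0)"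
      using rs by (intro sum.cong) (auto simp: off)
    finally show "(A * E 1) $$ (r, s) = mat (n + 1) (n + 1) (\<lambda>(r, s). A $$ (r, r) * E 1 $$ (r, s)) $$ (r, s)"
      using rs by simp
  qed (use A in \<open>auto simp: E_def\<close>)
  have A': "A' \<in> carrier_mat (n + 1) (n + 1)" by (simp add: A'_def)
  have "E 1 * A' = A * E 1"
    unfolding Emult[OF A'] AE
  proof (rule cong_mat[OF refl refl])
    fix r s assume "r < n + 1" "s < n + 1"
    then show "(case (r, s) of (r, s) \<Rightarrow> A' $$ (r, s) + (if r = i then 1 * A' $$ (0, s) else 0))
        = (case (r, s) of (r, s) \<Rightarrow> A $$ (r, r) * E 1 $$ (r, s))"
      using i i0 off[of r s] off[of 0 s] by (auto simp: A'_def E_def)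
  qed
  moreover have "E 1 * E (- 1) = 1\<^sub>m (n + 1)"
  proof -
    have "E (- 1) \<in> carrier_mat (n + 1) (n + 1)" by (simp add: E_def)
    from Emult[OF this] show ?thesis using i0 by (intro eq_matI) (auto simp: E_def)
  qed
  ultimately have "card (semi_invariants n d A c) \<le> card (semi_invariants n d A' c)"
    using A A' by (intro card_semi_invariants_conjugate[of A n A' "E 1" "E (- 1)"]) (auto simp: E_def)
  moreover have "A' $$ (i, 0) \<noteq> 0" using i by (simp add: A'_def)
  ultimately show ?thesis
    using card_semi_invariants_off_diagonal[OF i(1) _ i0 _ c a, of A'] by (meson le0 le_trans mult_le_mono1)
qed

section \<open>The order of the projective linear group\<close>

lemma carrier_mat_card:
  shows "finite (carrier_mat m m :: 'a::finite mat set)"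
    and "card (carrier_mat m m :: 'a::finite mat set) = CARD('a) ^ (m * m)"
proof -
  let ?I = "{..<m} \<times> {..<m}"
  have "bij_betw (\<lambda>A. restrict (($$) A) ?I) (carrier_mat m m) (?I \<rightarrow>\<^sub>E (UNIV :: 'a set))"
  proof (rule bij_betw_imageI)
    show "inj_on (\<lambda>A. restrict (($$) A) ?I) (carrier_mat m m :: 'a mat set)"
    proof (rule inj_onI)
      fix A B :: "'a mat"
      assume AB: "A \<in> carrier_mat m m" "B \<in> carrier_mat m m" and eq: "restrict (($$) A) ?I = restrict (($$) B) ?I"
      have "A $$ (r, s) = B $$ (r, s)" if "r < m" "s < m" for r s
        using fun_cong[OF eq, of "(r, s)"] that by simp
      then show "A = B" using AB by (intro eq_matI) auto
    qed
    show "(\<lambda>A. restrict (($$) A) ?I) ` carrier_mat m m = (?I \<rightarrow>\<^sub>E (UNIV :: 'a set))"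
    proof (intro equalityI subsetI)
      fix h :: "nat \<times> nat \<Rightarrow> 'a" assume "h \<in> ?I \<rightarrow>\<^sub>E UNIV"
      then have "h = restrict (($$) (mat m m h)) ?I" by (auto simp: fun_eq_iff PiE_def extensional_def)
      then show "h \<in> (\<lambda>A. restrict (($$) A) ?I) ` carrier_mat m m" using mat_carrier by blast
    qed (elim imageE, simp only: restrict_PiE_iff UNIV_I, simp)
  qed
  moreover have "card (?I \<rightarrow>\<^sub>E (UNIV :: 'a set)) = CARD('a) ^ (m * m)"
    by (subst card_funcsetE) (simp_all add: card_cartesian_product)
  moreover have "finite (?I \<rightarrow>\<^sub>E (UNIV :: 'a set))" by (intro finite_PiE) simp_all
  ultimately show "finite (carrier_mat m m :: 'a mat set)" "card (carrier_mat m m :: 'a mat set) = CARD('a) ^ (m * m)"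
    using bij_betw_finite bij_betw_same_card by metis+
qed

text \<open>The minors along the top row do not involve that row, so the column selected in the next
  proof survives the change of an entry there.\<close>

lemma cofactor_top_row_cong:
  assumes "A \<in> carrier_mat m m" "B \<in> carrier_mat m m"
    and "\<And>r s. 0 < r \<Longrightarrow> r < m \<Longrightarrow> s < m \<Longrightarrow> A $$ (r, s) = B $$ (r, s)"
  shows "cofactor A 0 j = cofactor B 0 j"
proof -
  have "mat_delete A 0 j = mat_delete B 0 j"
    using assms by (auto simp: mat_delete_def intro!: cong_mat)
  then show ?thesis by (simp add: cofactor_def)
qed

text \<open>Changing one suitable entry of the top row makes an invertible matrix singular, and the matrix
  is recovered from the result and the (nonzero) change.\<close>

lemma card_nonzero_det:
  fixes m :: nat
  assumes "m > 0"
  shows "card {A \<in> carrier_mat m m. det (A :: 'a::{field,finite} mat) \<noteq> 0} * CARD('a) \<le> (CARD('a) - 1) * CARD('a) ^ (m * m)"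
proof -
  let ?I = "{A \<in> carrier_mat m m. det (A :: 'a mat) \<noteq> 0}" and ?S = "{A \<in> carrier_mat m m. det (A :: 'a mat) = 0}"
  define j where "j A = (LEAST j. j < m \<and> cofactor A 0 j \<noteq> 0)" for A :: "'a mat"
  have j: "j A < m \<and> cofactor A 0 (j A) \<noteq> 0" if "A \<in> ?I" for A
  proof -
    have "\<exists>k. k < m \<and> cofactor A 0 k \<noteq> 0"
    proof (rule ccontr)
      assume "\<not> ?thesis"
      then have "det A = 0" using that assms by (simp add: laplace_expansion_row[of A m 0])
      then show False using that by simp
    qed
    then show ?thesis unfolding j_def by (rule LeastI_ex)
  qed
  \<comment> \<open>The determinant is affine in the entry at \<open>(0, j A)\<close> with slope the
    cofactor, so lowering that entry by this amount makes it 0.\<close>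
  define \<epsilon> where "\<epsilon> A = det A / cofactor A 0 (j A)" for A :: "'a mat"
  define \<psi> where "\<psi> A = mat m m (\<lambda>(r, s). if r = 0 \<and> s = j A then A $$ (r, s) - \<epsilon> A else A $$ (r, s))" for A :: "'a mat"
  have psi: "\<psi> A \<in> carrier_mat m m" for A by (simp add: \<psi>_def)
  have cof: "cofactor (\<psi> A) 0 = cofactor A 0" if "A \<in> ?I" for A
    using that by (intro ext cofactor_top_row_cong[of _ m]) (auto simp: \<psi>_def)
  have j_psi: "j (\<psi> A) = j A" if "A \<in> ?I" for A
    unfolding j_def cof[OF that] ..
  have inj: "inj_on (\<lambda>A. (\<psi> A, \<epsilon> A)) ?I"
  proof (rule inj_onI)
    fix A B assume A: "A \<in> ?I" and B: "B \<in> ?I" and eq: "(\<psi> A, \<epsilon> A) = (\<psi> B, \<epsilon> B)"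
    have jj: "j A = j B" using j_psi[OF A] j_psi[OF B] eq by simp
    have "A $$ (r, s) = B $$ (r, s)" if "r < m" "s < m" for r s
    proof -
      have "\<psi> A $$ (r, s) = \<psi> B $$ (r, s)" "\<epsilon> A = \<epsilon> B" using eq by simp_all
      then show ?thesis using that unfolding \<psi>_def jj by (simp split: if_splits)
    qed
    then show "A = B" using A B by (intro eq_matI) auto
  qed
  have "(\<lambda>A. (\<psi> A, \<epsilon> A)) ` ?I \<subseteq> ?S \<times> (UNIV - {0})"
  proof (rule image_subsetI)
    fix A assume A: "A \<in> ?I"
    have "det (\<psi> A) = (\<Sum>k<m. \<psi> A $$ (0, k) * cofactor A 0 k)"
      using laplace_expansion_row[OF psi assms] cof[OF A] by simp
    also have "\<dots> = (\<Sum>k<m. A $$ (0, k) * cofactor A 0 k - (if k = j A then \<epsilon> A * cofactor A 0 (j A) else 0))"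
      using assms by (intro sum.cong) (auto simp: \<psi>_def algebra_simps)
    also have "\<dots> = det A - \<epsilon> A * cofactor A 0 (j A)"
      using j[OF A] laplace_expansion_row[of A m 0] A assms by (simp add: sum_subtractf)
    also have "\<dots> = 0" using j[OF A] by (simp add: \<epsilon>_def)
    finally show "(\<psi> A, \<epsilon> A) \<in> ?S \<times> (UNIV - {0})"
      using psi j[OF A] A by (simp add: \<epsilon>_def)
  qed
  then have "card ?I \<le> card (?S \<times> (UNIV - {0 :: 'a}))"
    by (intro card_inj_on_le[OF inj] finite_cartesian_product) (auto intro: finite_subset[OF _ carrier_mat_card(1)[of m]])
  then have le: "card ?I \<le> card ?S * (CARD('a) - 1)" by (simp add: card_cartesian_product card_Diff_singleton)
  have "card ?I + card ?S = card (carrier_mat m m :: 'a mat set)"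
    by (subst card_Un_disjoint[symmetric]) (auto intro: finite_subset[OF _ carrier_mat_card(1)[of m]] arg_cong[of _ _ card])
  then have tot: "card ?I + card ?S = CARD('a) ^ (m * m)" by (simp add: carrier_mat_card(2))
  have "card ?I * CARD('a) = card ?I * (CARD('a) - 1) + card ?I"
    by (cases "CARD('a)") simp_all
  \<comment> \<open>The injection gives at most \<open>q - 1\<close> invertible matrices per
    singular one; adding up the two classes yields the total number of matrices.\<close>
  also have "\<dots> \<le> card ?I * (CARD('a) - 1) + card ?S * (CARD('a) - 1)" using le by simp
  also have "\<dots> = (CARD('a) - 1) * CARD('a) ^ (m * m)" unfolding tot[symmetric] by (simp only: distrib_left mult.commute)
  finally show ?thesis .
qed

lemma GL_carrier_iff:
  "A \<in> carrier (GL TYPE('a::field) m) \<longleftrightarrow>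
     A \<in> carrier_mat m m \<and> (\<exists>B\<in>carrier_mat m m. A * B = 1\<^sub>m m \<and> B * A = 1\<^sub>m m)"
  by (auto simp: GL_def units_of_def Units_def ring_mat_simps)

lemma GL_det:
  assumes "A \<in> carrier (GL TYPE('a::field) m)"
  shows "det A \<noteq> 0"
proof -
  obtain B where "A \<in> carrier_mat m m" "B \<in> carrier_mat m m" "A * B = 1\<^sub>m m"
    using assms by (auto simp: GL_carrier_iff)
  then have "det A * det B = 1" using det_mult[of A m B] by simp
  then show ?thesis by auto
qed

lemma two_le_CARD: "2 \<le> CARD('a::{zero_neq_one,finite})"
  using card_mono[of UNIV "{0, 1 :: 'a}"] by simp

text \<open>At most the fraction \<open>1 - 1 / q\<close> of all matrices is invertible, and
  \<open>q - 1\<close> of them are nonzero scalars. The quotient saves a full factor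
  \<open>q\<close>, which is spent at the end of the main count.\<close>

lemma card_PGL:
  assumes "m > 0"
  shows "finite (carrier (PGL TYPE('a::{field,finite}) m))"
    and "card (carrier (PGL TYPE('a::{field,finite}) m)) \<le> CARD('a) ^ (m * m - 1)"
proof -
  let ?G = "GL TYPE('a) m" and ?H = "scalar_mats TYPE('a) m" and ?q = "CARD('a)"
  interpret group ?G by (rule group_GL)
  have H: "subgroup ?H ?G" using scalar_mats_normal normal_imp_subgroup by blast
  have sub: "carrier ?G \<subseteq> {A \<in> carrier_mat m m. det A \<noteq> 0}" using GL_det GL_carrier_iff by blast
  have fin: "finite (carrier ?G)"
    by (rule finite_subset[OF _ carrier_mat_card(1)[of m]]) (auto simp: GL_carrier_iff)
  have PGL: "carrier (PGL TYPE('a) m) = rcosets\<^bsub>?G\<^esub> ?H" by (simp add: PGL_def FactGroup_def)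
  show "finite (carrier (PGL TYPE('a) m))"
    unfolding PGL by (rule finite_UnionD) (simp add: rcosets_part_G[OF H] fin)
  have "inj_on (\<lambda>c::'a. c \<cdot>\<^sub>m 1\<^sub>m m) (UNIV - {0})"
  proof (rule inj_onI)
    fix c e :: 'a assume "c \<cdot>\<^sub>m 1\<^sub>m m = e \<cdot>\<^sub>m (1\<^sub>m m :: 'a mat)"
    from arg_cong[OF this, of "\<lambda>A. A $$ (0, 0)"] show "c = e" using assms by simp
  qed
  moreover have "?H = (\<lambda>c::'a. c \<cdot>\<^sub>m 1\<^sub>m m) ` (UNIV - {0})" by (auto simp: scalar_mats_def)
  ultimately have cH: "card ?H = ?q - 1" by (simp add: card_image card_Diff_singleton)
  have q: "?q \<ge> 2" by (rule two_le_CARD)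
  have "card (carrier (PGL TYPE('a) m)) * (?q - 1) = card (carrier ?G)"
    using lagrange_finite[OF fin H] by (simp add: cH PGL Coset.order_def)
  also have "\<dots> \<le> card {A \<in> carrier_mat m m. det (A :: 'a mat) \<noteq> 0}"
    by (rule card_mono[OF _ sub]) (auto intro: finite_subset[OF _ carrier_mat_card(1)[of m]])
  finally have "card (carrier (PGL TYPE('a) m)) * (?q - 1) * ?q \<le> (?q - 1) * ?q ^ (m * m)"
    using card_nonzero_det[OF assms, where ?'a = 'a] by (meson le_trans mult_le_mono1)
  also have "?q ^ (m * m) = ?q ^ (m * m - 1) * ?q" using assms by (simp flip: power_Suc2)
  finally have "card (carrier (PGL TYPE('a) m)) * ((?q - 1) * ?q) \<le> ?q ^ (m * m - 1) * ((?q - 1) * ?q)"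
    by (simp only: mult_ac)
  then show "card (carrier (PGL TYPE('a) m)) \<le> ?q ^ (m * m - 1)" using q by simp
qed

section \<open>Automorphisms of smooth hypersurfaces\<close>

lemma lookup_mpoly_ac: "Poly_Mapping.lookup (mpoly_ac f) m = to_ac (Poly_Mapping.lookup f m)"
  by (simp add: mpoly_ac_def map.rep_eq when_def)

lemma keys_mpoly_ac: "Poly_Mapping.keys (mpoly_ac f) = Poly_Mapping.keys f"
  by (auto simp: in_keys_iff lookup_mpoly_ac)

lemma form_mpoly_ac: "form n d (mpoly_ac f) \<longleftrightarrow> form n d f"
  by (simp add: form_def keys_mpoly_ac)

lemma peval_mpoly_ac: "peval id x (mpoly_ac f) = peval to_ac x f"
  by (simp add: peval_def keys_mpoly_ac lookup_mpoly_ac)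

lemma eval_mpoly_vec:
  assumes "\<And>m. m \<in> Poly_Mapping.keys F \<Longrightarrow> Poly_Mapping.keys m \<subseteq> {..n}"
  shows "eval_mpoly F (vec (n + 1) x) = peval id x F"
  unfolding eval_mpoly_peval peval_def
proof (intro sum.cong refl arg_cong2[of _ _ _ _ "(*)"] mval_cong)
  fix m i assume "m \<in> Poly_Mapping.keys F" "i \<in> Poly_Mapping.keys m"
  then have "i < n + 1" using assms by fastforce
  then show "vec (n + 1) x $ i = x i" by (rule index_vec)
qed

lemma keys_partial_deriv:
  assumes F: "form n d F" and "m \<in> Poly_Mapping.keys (partial_deriv i F)"
  shows "Poly_Mapping.keys m \<subseteq> {..n}"
proof -
  have "m \<in> (\<Union>m'\<in>Poly_Mapping.keys F. Poly_Mapping.keys (Poly_Mapping.single (m' - Poly_Mapping.single i 1)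
      (of_nat (Poly_Mapping.lookup m' i) * Poly_Mapping.lookup F m')))"
    using assms(2) unfolding partial_deriv_def by (rule subsetD[OF keys_sum])
  then obtain m' where "m' \<in> Poly_Mapping.keys F" "m = m' - Poly_Mapping.single i 1"
    by (auto split: if_splits)
  moreover have "Poly_Mapping.keys (m' - Poly_Mapping.single i 1) \<subseteq> Poly_Mapping.keys m'"
    by (auto simp: in_keys_iff lookup_minus)
  ultimately show ?thesis using F by (auto simp: form_def)
qed

lemma mval_scale: "mval (\<lambda>k. c * y k) m = c ^ mdeg m * mval y m"
  by (simp add: mval_def mdeg_def power_mult_distrib prod.distrib power_sum)

lemma eval_mpoly_scale:
  fixes v :: "'k::field vec"
  assumes F: "form n d F" and v: "v \<in> carrier_vec (n + 1)"
  shows "eval_mpoly F (c \<cdot>\<^sub>v v) = c ^ d * eval_mpoly F v"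
proof -
  have "eval_mpoly F (c \<cdot>\<^sub>v v) = peval id (\<lambda>k. c * v $ k) F"
    unfolding eval_mpoly_peval using v by (intro peval_cong[OF F]) auto
  also have "\<dots> = c ^ d * eval_mpoly F v"
    unfolding eval_mpoly_peval peval_def sum_distrib_left
    using F by (intro sum.cong) (auto simp: form_iff mval_scale)
  finally show ?thesis .
qed

text \<open>The transform of \<open>f\<close> vanishes on the hypersurface, so over the closure it
  is a multiple of \<open>f\<close> by \<open>smooth_form_vanishing\<close>. The factor is a
  quotient of coefficients, hence lies in the base field, and is nonzero because an invertible
  substitution is injective.\<close>

lemma stabilizer_semi_invariant:
  fixes f :: "'a::field mpoly"
  assumes n: "n \<ge> 1" and d: "d \<ge> 1" and f: "f \<noteq> 0" "form n d f" "smooth_form n f"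
    and A: "A \<in> carrier (GL TYPE('a) (n + 1))"
    and stab: "\<And>v. v \<in> carrier_vec (n + 1) \<Longrightarrow> v \<noteq> 0\<^sub>v (n + 1) \<Longrightarrow> eval_mpoly (mpoly_ac f) v = 0 \<Longrightarrow>
      eval_mpoly (mpoly_ac f) (map_mat to_ac A *\<^sub>v v) = 0"
  shows "\<exists>c. c \<noteq> 0 \<and> f \<in> semi_invariants n d A c"
proof -
  interpret T: comm_ring_hom "to_ac :: 'a \<Rightarrow> 'a alg_closure" by (rule comm_ring_hom_to_ac)
  define F where "F = mpoly_ac f"
  define h where "h = lin_subst n A f"
  have F: "form n d F" using f by (simp add: F_def form_mpoly_ac)
  have h: "form n d h" unfolding h_def by (rule form_lin_subst[OF f(2)])
  have A': "A \<in> carrier_mat (n + 1) (n + 1)" using A by (simp add: GL_carrier_iff)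
  have evF: "eval_mpoly F (vec (n + 1) x) = peval id x F" for x
    by (rule eval_mpoly_vec) (use F in \<open>simp add: form_def\<close>)
  have nz: "vec (n + 1) x \<noteq> 0\<^sub>v (n + 1)" if x: "\<exists>i\<le>n. x i \<noteq> 0" for x :: "nat \<Rightarrow> 'a alg_closure"
  proof (rule notI)
    assume eq: "vec (n + 1) x = 0\<^sub>v (n + 1)"
    obtain i where i: "i \<le> n" "x i \<noteq> 0" using x by blast
    have "vec (n + 1) x $ i = 0\<^sub>v (n + 1) $ i" by (simp only: eq)
    then show False using i by simp
  qed
  have "\<exists>c. mpoly_ac h = Cst c * F"
  proof (rule smooth_form_vanishing[OF n d F])
    show "F \<noteq> 0" using f(1) keys_mpoly_ac[of f] unfolding F_def by (metis keys_eq_empty)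
    show "form n d (mpoly_ac h)" using h by (simp add: form_mpoly_ac)
    fix x :: "nat \<Rightarrow> 'a alg_closure" assume x: "\<exists>i\<le>n. x i \<noteq> 0" and Fx: "peval id x F = 0"
    have pd: "eval_mpoly (partial_deriv i F) (vec (n + 1) x) = peval id x (partial_deriv i F)" for i
      by (intro eval_mpoly_vec keys_partial_deriv[OF F])
    have F0: "eval_mpoly F (vec (n + 1) x) = 0" unfolding evF by (rule Fx)
    show "\<exists>i\<le>n. peval id x (partial_deriv i F) \<noteq> 0"
      using f(3) nz[OF x] F0 vec_carrier[of "n + 1" x] pd unfolding smooth_form_def F_def[symmetric] by metis
    have "map_mat to_ac A *\<^sub>v vec (n + 1) x = vec (n + 1) (\<lambda>k. \<Sum>l\<le>n. to_ac (A $$ (k, l)) * x l)"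
      using A' by (intro eq_vecI) (auto simp: scalar_prod_def atLeast0LessThan lessThan_Suc_atMost intro!: sum.cong)
    moreover have "eval_mpoly F (map_mat to_ac A *\<^sub>v vec (n + 1) x) = 0"
      unfolding F_def by (rule stab[OF vec_carrier nz[OF x] F0[unfolded F_def]])
    ultimately have "peval id (\<lambda>k. \<Sum>l\<le>n. to_ac (A $$ (k, l)) * x l) F = 0" by (simp only: evF)
    then show "peval id x (mpoly_ac h) = 0"
      unfolding h_def F_def peval_mpoly_ac T.peval_lin_subst .
  qed
  then obtain c where c: "mpoly_ac h = Cst c * F" by blast
  have lc: "to_ac (Poly_Mapping.lookup h m) = c * to_ac (Poly_Mapping.lookup f m)" for m
    using arg_cong[OF c, of "\<lambda>p. Poly_Mapping.lookup p m"] by (simp add: lookup_mpoly_ac lookup_Cst_mult F_def)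
  obtain m0 where "m0 \<in> Poly_Mapping.keys f" using f(1) by (metis ex_in_conv keys_eq_empty)
  then have m0: "Poly_Mapping.lookup f m0 \<noteq> 0" by (simp add: in_keys_iff)
  define e where "e = Poly_Mapping.lookup h m0 / Poly_Mapping.lookup f m0"
  have e: "to_ac e = c" using lc[of m0] m0 by (simp add: e_def)
  have he: "h = Cst e * f"
    by (rule poly_mapping_eqI) (use lc in \<open>simp add: lookup_Cst_mult e[symmetric] flip: to_ac_mult\<close>)
  have "e \<noteq> 0"
  proof
    assume "e = 0"
    then have "lin_subst n A f = lin_subst n A 0" using he by (simp add: h_def lin_subst_def peval_def)
    then show False
      using lin_subst_inj[OF f(2) form_0 _ A'] A f(1) by (auto simp: GL_carrier_iff)
  qed
  then show ?thesis using he f(2) by (auto simp: semi_invariants_def h_def)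
qed

section \<open>The action of the projective linear group on points\<close>

lemma PGL_one: "\<one>\<^bsub>PGL TYPE('a::field) m\<^esub> = scalar_mats TYPE('a) m"
  by (simp add: PGL_def FactGroup_def)

lemma PGL_act_one:
  fixes v :: "'a::field alg_closure vec"
  assumes "v \<in> carrier_vec m"
  shows "PGL_act (scalar_mats TYPE('a) m) (proj_point v) = proj_point v"
proof -
  have act: "map_mat to_ac (c \<cdot>\<^sub>m 1\<^sub>m m :: 'a mat) *\<^sub>v (e \<cdot>\<^sub>v v) = (to_ac c * e) \<cdot>\<^sub>v v" for c e
  proof -
    have "(\<Sum>k\<in>{0..<m}. to_ac (c * (if i = k then 1 else 0)) * (e * v $ k)) = to_ac c * e * v $ i" if "i < m" for i
    proof -
      have "(\<Sum>k\<in>{0..<m}. to_ac (c * (if i = k then 1 else 0)) * (e * v $ k))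
          = (\<Sum>k\<in>{0..<m}. if k = i then to_ac c * e * v $ i else 0)" by (intro sum.cong) auto
      then show ?thesis using that by simp
    qed
    then show ?thesis using assms by (intro eq_vecI) (auto simp: scalar_prod_def)
  qed
  show ?thesis
  proof (intro equalityI subsetI)
    fix x assume "x \<in> PGL_act (scalar_mats TYPE('a) m) (proj_point v)"
    then obtain c e where "c \<noteq> 0" "e \<noteq> 0" "x = map_mat to_ac (c \<cdot>\<^sub>m 1\<^sub>m m :: 'a mat) *\<^sub>v (e \<cdot>\<^sub>v v)"
      by (auto simp: PGL_act_def scalar_mats_def proj_point_def)
    then show "x \<in> proj_point v" unfolding act by (auto simp: proj_point_def)
  next
    fix x assume "x \<in> proj_point v"
    then obtain e where e: "e \<noteq> 0" "x = e \<cdot>\<^sub>v v" by (auto simp: proj_point_def)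
    have "x = map_mat to_ac (1 \<cdot>\<^sub>m 1\<^sub>m m :: 'a mat) *\<^sub>v (e \<cdot>\<^sub>v v)" unfolding act e by simp
    moreover have "1 \<cdot>\<^sub>m 1\<^sub>m m \<in> scalar_mats TYPE('a) m" unfolding scalar_mats_def by (intro CollectI exI[of _ 1]) simp
    moreover have "e \<cdot>\<^sub>v v \<in> proj_point v" using e by (auto simp: proj_point_def)
    ultimately show "x \<in> PGL_act (scalar_mats TYPE('a) m) (proj_point v)" unfolding PGL_act_def by blast
  qed
qed

text \<open>Guarantees that an automorphism set other than the trivial one contains a nontrivial
  element.\<close>

lemma one_in_Aut: "\<one>\<^bsub>PGL TYPE('a::field) (n + 1)\<^esub> \<in> Aut n (zero_locus n (f :: 'a mpoly))"
proof -
  have "PGL_act (scalar_mats TYPE('a) (n + 1)) y = y" if "y \<in> zero_locus n f" for y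
    using that PGL_act_one by (auto simp: zero_locus_def)
  then have "PGL_act (scalar_mats TYPE('a) (n + 1)) ` zero_locus n f = zero_locus n f" by force
  moreover have "\<one>\<^bsub>PGL TYPE('a) (n + 1)\<^esub> \<in> carrier (PGL TYPE('a) (n + 1))"
    using group.is_monoid[OF group_PGL] by (rule monoid.one_closed)
  ultimately show ?thesis by (simp add: Aut_def PGL_one)
qed

lemma Aut_stabilizes:
  fixes f :: "'a::field mpoly"
  assumes f: "form n d f" and g: "g \<in> Aut n (zero_locus n f)" "A \<in> g"
    and v: "v \<in> carrier_vec (n + 1)" "v \<noteq> 0\<^sub>v (n + 1)" "eval_mpoly (mpoly_ac f) v = 0"
  shows "eval_mpoly (mpoly_ac f) (map_mat to_ac A *\<^sub>v v) = 0"
proof -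
  have "proj_point v \<in> zero_locus n f" using v by (auto simp: zero_locus_def)
  then have "PGL_act g (proj_point v) \<in> zero_locus n f" using g by (auto simp: Aut_def)
  then obtain w where w: "w \<in> carrier_vec (n + 1)" "eval_mpoly (mpoly_ac f) w = 0" "PGL_act g (proj_point v) = proj_point w"
    by (auto simp: zero_locus_def)
  have "v \<in> proj_point v" unfolding proj_point_def by (intro CollectI exI[of _ 1]) simp
  then have "map_mat to_ac A *\<^sub>v v \<in> PGL_act g (proj_point v)" using g(2) by (auto simp: PGL_act_def)
  then obtain c where "map_mat to_ac A *\<^sub>v v = c \<cdot>\<^sub>v w" unfolding w(3) by (auto simp: proj_point_def)
  then show ?thesis using eval_mpoly_scale[of n d "mpoly_ac f" w c] f w by (simp add: form_mpoly_ac)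
qed

text \<open>Cosets are disjoint, so a nontrivial one contains no nonzero scalar matrix; the zero
  matrix is excluded by its determinant.\<close>

lemma PGL_coset:
  assumes g: "g \<in> carrier (PGL TYPE('a::field) m)" and A: "A \<in> g"
  shows "A \<in> carrier (GL TYPE('a) m)"
    and "g \<noteq> \<one>\<^bsub>PGL TYPE('a) m\<^esub> \<Longrightarrow> m > 0 \<Longrightarrow> A \<noteq> e \<cdot>\<^sub>m 1\<^sub>m m"
proof -
  let ?G = "GL TYPE('a) m" and ?H = "scalar_mats TYPE('a) m"
  interpret group ?G by (rule group_GL)
  have H: "subgroup ?H ?G" using scalar_mats_normal normal_imp_subgroup by blast
  have g': "g \<in> rcosets\<^bsub>?G\<^esub> ?H" using g by (simp add: PGL_def FactGroup_def)
  show AG: "A \<in> carrier ?G" using rcosets_part_G[OF H] g' A by blast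
  assume ne: "g \<noteq> \<one>\<^bsub>PGL TYPE('a) m\<^esub>" and m: "m > 0"
  show "A \<noteq> e \<cdot>\<^sub>m 1\<^sub>m m"
  proof
    assume Ae: "A = e \<cdot>\<^sub>m 1\<^sub>m m"
    have "e \<noteq> 0" using GL_det[OF AG] m by (auto simp: Ae det_smult)
    then have "A \<in> ?H" using Ae by (auto simp: scalar_mats_def)
    moreover have "?H \<in> rcosets\<^bsub>?G\<^esub> ?H" by (rule subgroup.subgroup_in_rcosets[OF H group_GL])
    ultimately have "g = ?H"
      using rcos_disjoint[OF H] g' A by (auto simp: pairwise_def disjnt_iff)
    then show False using ne by (simp add: PGL_one)
  qed
qed

lemma PGL_nonempty: "g \<in> carrier (PGL TYPE('a::field) m) \<Longrightarrow> g \<noteq> {}"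
  using subgroup.rcosets_non_empty[OF normal_imp_subgroup[OF scalar_mats_normal]]
  by (auto simp: PGL_def FactGroup_def)

section \<open>Counting hypersurfaces\<close>

lemma zero_locus_Cst_mult:
  assumes "c \<noteq> 0"
  shows "zero_locus n (Cst c * f) = zero_locus n (f :: 'a::field mpoly)"
proof -
  have "mpoly_ac (Cst c * f) = Cst (to_ac c) * mpoly_ac f"
    by (rule poly_mapping_eqI) (simp add: lookup_mpoly_ac lookup_Cst_mult)
  then have "eval_mpoly (mpoly_ac (Cst c * f)) v = to_ac c * eval_mpoly (mpoly_ac f) v" for v
    unfolding eval_mpoly_peval
    by (simp add: comm_ring_hom.peval_mult[OF comm_ring_hom_id] comm_ring_hom.peval_Cst[OF comm_ring_hom_id])
  then show ?thesis using assms by (simp add: zero_locus_def)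
qed

text \<open>After choosing one form per locus, its \<open>q - 1\<close> nonzero multiples are
  distinct, stay in \<open>S\<close> and define the same locus.\<close>

lemma card_zero_loci:
  fixes S :: "'a::{field,finite} mpoly set"
  assumes "finite S" "0 \<notin> S" and scale: "\<And>c f. c \<noteq> 0 \<Longrightarrow> f \<in> S \<Longrightarrow> Cst c * f \<in> S"
  shows "card (zero_locus n ` S) * (CARD('a) - 1) \<le> card S"
proof -
  define F where "F = inv_into S (zero_locus n)"
  have F: "F Y \<in> S" "zero_locus n (F Y) = Y" if "Y \<in> zero_locus n ` S" for Y
    using inv_into_into[OF that] f_inv_into_f[OF that] by (simp_all add: F_def)
  have "inj_on (\<lambda>(Y, c). Cst c * F Y) (zero_locus n ` S \<times> (UNIV - {0 :: 'a}))"
  proof (rule inj_onI)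
    fix z z'
    assume z: "z \<in> zero_locus n ` S \<times> (UNIV - {0 :: 'a})" "z' \<in> zero_locus n ` S \<times> (UNIV - {0 :: 'a})"
      and eqz: "(case z of (Y, c) \<Rightarrow> Cst c * F Y) = (case z' of (Y, c) \<Rightarrow> Cst c * F Y)"
    obtain Y c Y' c' where zz: "z = (Y, c)" "z' = (Y', c')" by (metis surj_pair)
    have Y: "Y \<in> zero_locus n ` S" "Y' \<in> zero_locus n ` S" and c: "c \<noteq> 0" "c' \<noteq> 0"
      and eq: "Cst c * F Y = Cst c' * F Y'" using z eqz by (simp_all add: zz)
    have "zero_locus n (Cst c * F Y) = zero_locus n (Cst c' * F Y')" by (simp only: eq)
    then have "Y = Y'" using F(2) Y c by (simp add: zero_locus_Cst_mult)
    moreover have "F Y \<noteq> 0" using F(1)[OF Y(1)] assms(2) by metis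
    then obtain m where "Poly_Mapping.lookup (F Y) m \<noteq> 0" by (metis lookup_zero poly_mapping_eqI)
    then have "c = c'" using arg_cong[OF eq, of "\<lambda>p. Poly_Mapping.lookup p m"] \<open>Y = Y'\<close> by (simp add: lookup_Cst_mult)
    ultimately show "z = z'" by (simp add: zz)
  qed
  then have "card (zero_locus n ` S \<times> (UNIV - {0 :: 'a})) \<le> card S"
    by (rule card_inj_on_le) (use scale F(1) assms(1) in auto)
  then show ?thesis by (simp add: card_cartesian_product card_Diff_singleton)
qed

theorem theorem2:
  fixes n d :: nat
  assumes "n \<ge> 1" and "d \<ge> 1"
    and "(n, d) \<noteq> (2, 3)" and "(n, d) \<noteq> (3, 4)"
  shows "real (card {Y :: 'a::{field,finite} alg_closure vec set set.
            smooth_hypersurface n d Y \<and> Aut n Y \<noteq> {\<one>\<^bsub>PGL TYPE('a) (n + 1)\<^esub>}})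
         < real CARD('a) powr ((1 - 1 / 2 ^ n) * real ((n + d) choose d) + real ((n + 1)^2))"
proof -
  let ?q = "real CARD('a)" and ?N = "(n + d) choose d"
  define Ys where "Ys = {Y :: 'a alg_closure vec set set. smooth_hypersurface n d Y \<and> Aut n Y \<noteq> {\<one>\<^bsub>PGL TYPE('a) (n + 1)\<^esub>}}"
  define P where "P = carrier (PGL TYPE('a) (n + 1)) - {\<one>\<^bsub>PGL TYPE('a) (n + 1)\<^esub>}"
  \<comment> \<open>Rounding down gives both \<open>d \<le> 2 * (d - k)\<close>, needed for the
    semi-invariants, and \<open>d \<le> 2 * k + 1\<close>, needed for the binomial estimate.\<close>
  define k where "k = d div 2"
  define b where "b = ((n + k) choose k) - 1"
  \<comment> \<open>Bounds the number of semi-invariants for one matrix and one eigenvalue, the zero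
    form included.\<close>
  define R where "R = ?q powr (real ?N - real b)"
  \<comment> \<open>One matrix per class suffices: a stabilizing class makes \<open>f\<close>
    semi-invariant under each of its matrices, with some nonzero eigenvalue.\<close>
  define rep where "rep g = (SOME A. A \<in> g)" for g :: "'a mat set"
  define S where "S g c = semi_invariants n d (rep g) c - {0}" for g c
  have q: "?q \<ge> 2" using two_le_CARD[where ?'a = 'a] by linarith
  have q1: "real (CARD('a) - 1) = ?q - 1" using two_le_CARD[where ?'a = 'a] by (subst of_nat_diff) linarith+
  have rep: "rep g \<in> g" if "g \<in> P" for g
    using PGL_nonempty[of g "n + 1"] that unfolding rep_def P_def by (simp add: some_in_eq)
  have finP: "finite P" and cardP: "real (card P) \<le> ?q ^ ((n + 1) * (n + 1) - 1)"
  proof -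
    show "finite P" unfolding P_def using card_PGL(1)[of "n + 1"] by simp
    have "card P \<le> card (carrier (PGL TYPE('a) (n + 1)))"
      unfolding P_def using card_PGL(1)[of "n + 1"] by (intro card_mono) auto
    also have "\<dots> \<le> CARD('a) ^ ((n + 1) * (n + 1) - 1)" by (rule card_PGL(2)) simp
    finally show "real (card P) \<le> ?q ^ ((n + 1) * (n + 1) - 1)" by (metis of_nat_le_iff of_nat_power)
  qed
  have "Ys \<subseteq> (\<Union>g\<in>P. \<Union>c\<in>UNIV - {0}. zero_locus n ` S g c)"
  proof
    fix Y assume "Y \<in> Ys"
    then have "smooth_hypersurface n d Y" and Aut: "Aut n Y \<noteq> {\<one>\<^bsub>PGL TYPE('a) (n + 1)\<^esub>}"
      by (simp_all add: Ys_def)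
    then obtain f :: "'a mpoly" where f: "f \<noteq> 0" "form n d f" "smooth_form n f" and Y: "Y = zero_locus n f"
      by (auto simp: smooth_hypersurface_def)
    obtain g where g: "g \<in> Aut n Y" "g \<noteq> \<one>\<^bsub>PGL TYPE('a) (n + 1)\<^esub>"
      using Aut one_in_Aut[of n f] unfolding Y by blast
    then have gP: "g \<in> P" by (simp add: P_def Aut_def)
    have "rep g \<in> carrier (GL TYPE('a) (n + 1))"
      using PGL_coset(1)[OF _ rep[OF gP]] gP by (simp add: P_def)
    then obtain c where "c \<noteq> 0" "f \<in> semi_invariants n d (rep g) c"
      using stabilizer_semi_invariant[OF assms(1,2) f] Aut_stabilizes[OF f(2) _ rep[OF gP]] g(1) Y by blast
    then have "f \<in> S g c" "c \<in> UNIV - {0}" using f(1) by (auto simp: S_def)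
    then show "Y \<in> (\<Union>g\<in>P. \<Union>c\<in>UNIV - {0}. zero_locus n ` S g c)" using gP Y by blast
  qed
  moreover have finS: "finite (S g c)" for g c by (simp add: S_def finite_semi_invariants)
  ultimately have "card Ys \<le> card (\<Union>g\<in>P. \<Union>c\<in>UNIV - {0}. zero_locus n ` S g c)"
    using finP by (intro card_mono) auto
  also have "\<dots> \<le> (\<Sum>g\<in>P. card (\<Union>c\<in>UNIV - {0}. zero_locus n ` S g c))" by (rule card_UN_le[OF finP])
  also have "\<dots> \<le> (\<Sum>g\<in>P. \<Sum>c\<in>UNIV - {0}. card (zero_locus n ` S g c))" by (intro sum_mono card_UN_le) simp
  finally have "real (card Ys) \<le> (\<Sum>g\<in>P. \<Sum>c\<in>UNIV - {0}. real (card (zero_locus n ` S g c)))"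
    by (simp flip: of_nat_sum)
  \<comment> \<open>Without the zero form at most \<open>R - 1\<close> semi-invariants remain, and
    each locus arises from at least \<open>q - 1\<close> of them. The sum over the
    \<open>q - 1\<close> eigenvalues then cancels the denominator.\<close>
  also have "\<dots> \<le> (\<Sum>g\<in>P. \<Sum>c\<in>UNIV - {0 :: 'a}. (R - 1) / (?q - 1))"
  proof (intro sum_mono)
    fix g and c :: 'a assume g: "g \<in> P" and c: "c \<in> UNIV - {0}"
    let ?A = "rep g"
    have A: "?A \<in> carrier_mat (n + 1) (n + 1)" "\<And>e. ?A \<noteq> e \<cdot>\<^sub>m 1\<^sub>m (n + 1)"
      using PGL_coset[OF _ rep[OF g]] g by (auto simp: P_def GL_carrier_iff)
    have "0 \<in> semi_invariants n d ?A c" by (simp add: semi_invariants_def lin_subst_def peval_def)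
    then have cS: "card (semi_invariants n d ?A c) = card (S g c) + 1"
      unfolding S_def using card.remove[OF finite_semi_invariants] by fastforce
    have "card (semi_invariants n d ?A c) * CARD('a) ^ b \<le> CARD('a) ^ ?N"
      unfolding b_def using c by (intro card_semi_invariants[OF A, of _ _ "d - k"]) (auto simp: k_def)
    then have "real (card (semi_invariants n d ?A c)) * ?q ^ b \<le> ?q ^ ?N"
      by (metis of_nat_le_iff of_nat_mult of_nat_power)
    then have "real (card (semi_invariants n d ?A c)) \<le> R"
      using q by (simp add: R_def powr_diff powr_realpow field_simps)
    then have R: "real (card (S g c)) \<le> R - 1" by (simp add: cS)
    have "card (zero_locus n ` S g c) * (CARD('a) - 1) \<le> card (S g c)"
    proof (rule card_zero_loci[OF finS])
      fix e :: 'a and f assume e: "e \<noteq> 0" and f: "f \<in> S g c"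
      have "lin_subst n ?A (Cst e * f) = Cst e * lin_subst n ?A f"
        unfolding comm_ring_hom.peval_mult[OF comm_ring_hom_Cst] lin_subst_def
          comm_ring_hom.peval_Cst[OF comm_ring_hom_Cst] ..
      then show "Cst e * f \<in> S g c"
        using e f by (auto simp: S_def semi_invariants_def form_Cst_mult mult.left_commute)
    qed (simp add: S_def)
    then have "real (card (zero_locus n ` S g c) * (CARD('a) - 1)) \<le> real (card (S g c))" by (rule of_nat_mono)
    then have "real (card (zero_locus n ` S g c)) * (?q - 1) \<le> real (card (S g c))" by (simp only: of_nat_mult q1)
    then show "real (card (zero_locus n ` S g c)) \<le> (R - 1) / (?q - 1)"
      using R q by (simp add: field_simps)
  qed
  also have "\<dots> = real (card P) * (R - 1)" using q by (simp add: card_Diff_singleton q1[simplified])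
  also have "\<dots> < ?q ^ ((n + 1) * (n + 1) - 1) * R"
  \<comment> \<open>Strictness comes from \<open>R - 1 < R\<close> if there is a nontrivial class;
    otherwise the left side is 0 and the right side positive.\<close>
  proof (cases "card P = 0")
    case False
    then have "real (card P) * (R - 1) < real (card P) * R" by simp
    also have "\<dots> \<le> ?q ^ ((n + 1) * (n + 1) - 1) * R" using cardP by (intro mult_right_mono) (simp_all add: R_def)
    finally show ?thesis .
  qed (use q in \<open>simp add: R_def\<close>)
  also have "\<dots> = ?q powr (real ((n + 1) * (n + 1) - 1) + (real ?N - real b))"
  proof -
    have "?q ^ ((n + 1) * (n + 1) - 1) = ?q powr real ((n + 1) * (n + 1) - 1)"
      by (rule powr_realpow[symmetric]) (use q in linarith)
    then show ?thesis by (simp only: R_def powr_add)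
  qed
  also have "\<dots> \<le> ?q powr ((1 - 1 / 2 ^ n) * real ?N + real ((n + 1)^2))"
  proof (rule powr_mono)
    \<comment> \<open>The 1 subtracted in \<open>b\<close> is compensated by the 1 saved in the
      exponent for the projective linear group.\<close>
    have "?N \<le> 2 ^ n * ((n + k) choose k)" by (rule binomial_half) (auto simp: k_def)
    also have "\<dots> = 2 ^ n * (b + 1)" by (simp add: b_def)
    finally have "real ?N \<le> real (2 ^ n * (b + 1))" by (rule of_nat_mono)
    then have "real ?N \<le> 2 ^ n * (real b + 1)" by (simp add: algebra_simps)
    then have "real ?N / 2 ^ n \<le> real b + 1" by (simp add: field_simps)
    moreover have "real ((n + 1) * (n + 1) - 1) = real ((n + 1)^2) - 1"
      by (simp add: power2_eq_square)
    ultimately show "real ((n + 1) * (n + 1) - 1) + (real ?N - real b) \<le> (1 - 1 / 2 ^ n) * real ?N + real ((n + 1)^2)"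
      by (simp add: algebra_simps)
  qed (use q in simp)
  finally show ?thesis unfolding Ys_def .
qed

end
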